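(* Let $n\ge1$ and $\Theta\subseteq\mathsf{FORM}_n$. Then $\mathsf{LIND}(\Theta)$ is semisimple if and only if $\Theta^{\models}=\Theta^{\models_\partial}=\Theta^{\vdash}$. Consequently, $\mathsf{LIND}(\Theta)$ is not semisimple if and only if there is $\psi\in\mathsf{FORM}_n$ such that every differential valuation of order $0$ satisfying $\Theta$ satisfies $\psi$, and there is a differential valuation $U$ satisfying $\Theta$ but not $\psi$.
   Context: $\mathsf{FORM}_n$ is the set of formulas of infinite-valued Łukasiewicz propositional logic in the variables $X_1,\dots,X_n$; $\Theta\vdash\psi$ denotes derivability from $\Theta$ (Łukasiewicz axioms, Modus Ponens). $\mathsf{LIND}(\Theta)$ is the Lindenbaum MV-algebra of $\Theta$: $\mathsf{FORM}_n$ modulo the equivalence $\phi\equiv_\Theta\psi$ iff $\Theta\vdash\phi\leftrightarrow\psi$. An MV-algebra is semisimple if the intersection of its maximal ideals is $\{0\}$. Each $\phi$ determines $\hat\phi\colon[0,1]^n\to[0,1]$ (truth value at the valuation $v\in[0,1]^n$, with $\neg x=1-x$, $x\oplus y=\min(1,x+y)$). $\Theta\models\psi$ iff every $v\in[0,1]^n$ with $\hat\theta(v)=1$ for all $\theta\in\Theta$ has $\hat\psi(v)=1$. Differential valuation in $\mathbb R^n$: for $0\le t\le n$, a tuple $U=(u_0,\dots,u_t)$ of vectors in $\mathbb R^n$ with $u_1,\dots,u_t$ pairwise orthogonal unit vectors, such that for all large integers $m$ the simplex $T_{U,m}=\mathrm{conv}(u_0,\,u_0+u_1/m,\dots,u_0+u_1/m+\cdots+u_t/m^t)$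 lies in $[0,1]^n$; $t$ is its order (order-$0$ ones are just points $u_0\in[0,1]^n$). $U$ satisfies $\psi$ if $\hat\psi=1$ on $T_{U,m}$ for some $m$; $U$ satisfies $\Theta$ if it satisfies each $\theta\in\Theta$. $\Theta\models_\partial\psi$ iff every differential valuation satisfying $\Theta$ satisfies $\psi$. For a consequence relation $R\in\{\models,\models_\partial,\vdash\}$, $\Theta^{R}=\{\psi\in\mathsf{FORM}_n\mid \Theta\,R\,\psi\}$. *)

theory Defs
  imports "HOL-Analysis.Analysis"
begin

section \<open>MV-algebras\<close>

record 'a mv =
  mv_carrier :: "'a set"
  mv_oplus :: "'a \<Rightarrow> 'a \<Rightarrow> 'a"
  mv_neg :: "'a \<Rightarrow> 'a"
  mv_zero :: "'a"

definition mv_one :: "('a, 'b) mv_scheme \<Rightarrow> 'a" where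
  "mv_one A = mv_neg A (mv_zero A)"

locale mv_algebra =
  fixes A :: "('a, 'b) mv_scheme"
  assumes zero_closed: "mv_zero A \<in> mv_carrier A"
    and neg_closed: "x \<in> mv_carrier A \<Longrightarrow> mv_neg A x \<in> mv_carrier A"
    and oplus_closed:
      "\<lbrakk>x \<in> mv_carrier A; y \<in> mv_carrier A\<rbrakk> \<Longrightarrow> mv_oplus A x y \<in> mv_carrier A"
    and oplus_assoc:
      "\<lbrakk>x \<in> mv_carrier A; y \<in> mv_carrier A; z \<in> mv_carrier A\<rbrakk> \<Longrightarrow>
        mv_oplus A (mv_oplus A x y) z = mv_oplus A x (mv_oplus A y z)"
    and oplus_comm:
      "\<lbrakk>x \<in> mv_carrier A; y \<in> mv_carrier A\<rbrakk> \<Longrightarrow> mv_oplus A x y = mv_oplus A y x"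
    and oplus_zero: "x \<in> mv_carrier A \<Longrightarrow> mv_oplus A x (mv_zero A) = x"
    and neg_neg: "x \<in> mv_carrier A \<Longrightarrow> mv_neg A (mv_neg A x) = x"
    and oplus_one: "x \<in> mv_carrier A \<Longrightarrow> mv_oplus A x (mv_one A) = mv_one A"
    and lukasiewicz:
      "\<lbrakk>x \<in> mv_carrier A; y \<in> mv_carrier A\<rbrakk> \<Longrightarrow>
        mv_oplus A (mv_neg A (mv_oplus A (mv_neg A x) y)) y =
        mv_oplus A (mv_neg A (mv_oplus A (mv_neg A y) x)) x"

definition mv_le :: "('a, 'b) mv_scheme \<Rightarrow> 'a \<Rightarrow> 'a \<Rightarrow> bool" where
  "mv_le A x y \<longleftrightarrow> mv_oplus A (mv_neg A x) y = mv_one A"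

definition mv_ideal :: "('a, 'b) mv_scheme \<Rightarrow> 'a set \<Rightarrow> bool" where
  "mv_ideal A I \<longleftrightarrow>
     I \<subseteq> mv_carrier A \<and> mv_zero A \<in> I \<and>
     (\<forall>x\<in>I. \<forall>y\<in>I. mv_oplus A x y \<in> I) \<and>
     (\<forall>x\<in>I. \<forall>y\<in>mv_carrier A. mv_le A y x \<longrightarrow> y \<in> I)"

definition mv_maximal_ideal :: "('a, 'b) mv_scheme \<Rightarrow> 'a set \<Rightarrow> bool" where
  "mv_maximal_ideal A I \<longleftrightarrow>
     mv_ideal A I \<and> I \<noteq> mv_carrier A \<and>
     (\<forall>J. mv_ideal A J \<and> I \<subseteq> J \<and> J \<noteq> mv_carrier A \<longrightarrow> J = I)"

text \<open>
  The intersection is taken inside the carrier. Thus the one-element MV-algebra, which has no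
  maximal ideal, is semisimple.
\<close>

definition mv_semisimple :: "('a, 'b) mv_scheme \<Rightarrow> bool" where
  "mv_semisimple A \<longleftrightarrow>
     mv_carrier A \<inter> \<Inter> {I. mv_maximal_ideal A I} = {mv_zero A}"


section \<open>Lukasiewicz logic\<close>

text \<open>
  The finite index type \<open>'n\<close> plays the role of \<open>{1,\<dots>,n}\<close>; as types are nonempty,
  \<open>n = CARD('n) \<ge> 1\<close>. Negation and implication are primitive, as in the axiomatisation below;
  the other connectives are defined.
\<close>

datatype 'n form = Var 'n | Neg "'n form" | Imp "'n form" "'n form"

definition Oplus :: "'n form \<Rightarrow> 'n form \<Rightarrow> 'n form" where
  "Oplus \<phi> \<psi> = Imp (Neg \<phi>) \<psi>"

definition Odot :: "'n form \<Rightarrow> 'n form \<Rightarrow> 'n form" where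
  "Odot \<phi> \<psi> = Neg (Oplus (Neg \<phi>) (Neg \<psi>))"

definition Equiv :: "'n form \<Rightarrow> 'n form \<Rightarrow> 'n form" where
  "Equiv \<phi> \<psi> = Odot (Imp \<phi> \<psi>) (Imp \<psi> \<phi>)"

inductive derives :: "'n form set \<Rightarrow> 'n form \<Rightarrow> bool" for \<Theta> where
  hyp: "\<phi> \<in> \<Theta> \<Longrightarrow> derives \<Theta> \<phi>"
| ax1: "derives \<Theta> (Imp \<phi> (Imp \<psi> \<phi>))"
| ax2: "derives \<Theta> (Imp (Imp \<phi> \<psi>) (Imp (Imp \<psi> \<gamma>) (Imp \<phi> \<gamma>)))"
| ax3: "derives \<Theta> (Imp (Imp (Imp \<phi> \<psi>) \<psi>) (Imp (Imp \<psi> \<phi>) \<phi>))"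
| ax4: "derives \<Theta> (Imp (Imp (Neg \<phi>) (Neg \<psi>)) (Imp \<psi> \<phi>))"
| mp: "derives \<Theta> \<phi> \<Longrightarrow> derives \<Theta> (Imp \<phi> \<psi>) \<Longrightarrow> derives \<Theta> \<psi>"

subsection \<open>The Lindenbaum algebra\<close>

definition lind_rel :: "'n form set \<Rightarrow> ('n form \<times> 'n form) set" where
  "lind_rel \<Theta> = {(\<phi>, \<psi>). derives \<Theta> (Equiv \<phi> \<psi>)}"

text \<open>The zero element is the class of the formulas refuted by \<open>\<Theta>\<close>.\<close>

definition LIND :: "'n form set \<Rightarrow> 'n form set mv" where
  "LIND \<Theta> =
     \<lparr> mv_carrier = UNIV // lind_rel \<Theta>,
       mv_oplus = (\<lambda>P Q. \<Union>\<phi>\<in>P. \<Union>\<psi>\<in>Q. lind_rel \<Theta> `` {Oplus \<phi> \<psi>}),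
       mv_neg = (\<lambda>P. \<Union>\<phi>\<in>P. lind_rel \<Theta> `` {Neg \<phi>}),
       mv_zero = {\<phi>. derives \<Theta> (Neg \<phi>)} \<rparr>"

subsection \<open>Semantics\<close>

text \<open>
  \<open>eval\<close> is total on \<open>\<real>\<^sup>n\<close>, but it is the truth value only on the unit cube
  \<open>cbox 0 1\<close>, where implication takes the usual value \<open>\<not>x \<oplus> y\<close>.
\<close>

primrec eval :: "'n::finite form \<Rightarrow> real ^ 'n \<Rightarrow> real" where
  "eval (Var i) v = v $ i"
| "eval (Neg \<phi>) v = 1 - eval \<phi> v"
| "eval (Imp \<phi> \<psi>) v = min 1 ((1 - eval \<phi> v) + eval \<psi> v)"

definition models :: "'n::finite form set \<Rightarrow> 'n form \<Rightarrow> bool" where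
  "models \<Theta> \<psi> \<longleftrightarrow>
     (\<forall>v\<in>cbox 0 1. (\<forall>\<theta>\<in>\<Theta>. eval \<theta> v = 1) \<longrightarrow> eval \<psi> v = 1)"

subsection \<open>Differential semantics\<close>

text \<open>A tuple \<open>(u\<^sub>0,\<dots>,u\<^sub>t)\<close> is a list \<open>U\<close> of length \<open>t + 1\<close>.\<close>

definition diff_simplex :: "(real ^ 'n) list \<Rightarrow> nat \<Rightarrow> (real ^ 'n::finite) set" where
  "diff_simplex U m =
     convex hull ((\<lambda>k. U ! 0 + (\<Sum>i=1..k. (1 / real m ^ i) *\<^sub>R U ! i)) ` {..<length U})"

definition diff_order :: "(real ^ 'n) list \<Rightarrow> nat" where
  "diff_order U = length U - 1"

definition diff_valuation :: "(real ^ 'n::finite) list \<Rightarrow> bool" where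
  "diff_valuation U \<longleftrightarrow>
     U \<noteq> [] \<and> diff_order U \<le> CARD('n) \<and>
     (\<forall>i\<in>{1..diff_order U}. norm (U ! i) = 1) \<and>
     (\<forall>i\<in>{1..diff_order U}. \<forall>j\<in>{1..diff_order U}. i \<noteq> j \<longrightarrow> orthogonal (U ! i) (U ! j)) \<and>
     (\<forall>\<^sub>F m in sequentially. diff_simplex U m \<subseteq> cbox 0 1)"

text \<open>
  The simplex must lie in the domain \<open>cbox 0 1\<close> of the truth function, and \<open>m > 0\<close> excludes
  the degenerate simplex \<open>{u\<^sub>0}\<close> that division by zero would produce.
\<close>

definition diff_sat :: "(real ^ 'n::finite) list \<Rightarrow> 'n form \<Rightarrow> bool" where
  "diff_sat U \<psi> \<longleftrightarrow>
     (\<exists>m>0. diff_simplex U m \<subseteq> cbox 0 1 \<and> (\<forall>v\<in>diff_simplex U m. eval \<psi> v = 1))"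

definition diff_sat_set :: "(real ^ 'n::finite) list \<Rightarrow> 'n form set \<Rightarrow> bool" where
  "diff_sat_set U \<Theta> \<longleftrightarrow> (\<forall>\<theta>\<in>\<Theta>. diff_sat U \<theta>)"

definition diff_models :: "'n::finite form set \<Rightarrow> 'n form \<Rightarrow> bool" where
  "diff_models \<Theta> \<psi> \<longleftrightarrow>
     (\<forall>U. diff_valuation U \<and> diff_sat_set U \<Theta> \<longrightarrow> diff_sat U \<psi>)"

definition conseq :: "('n form set \<Rightarrow> 'n form \<Rightarrow> bool) \<Rightarrow> 'n form set \<Rightarrow> 'n form set" where
  "conseq R \<Theta> = {\<psi>. R \<Theta> \<psi>}"


section \<open>Basic facts\<close>

lemma eval_in_unit: "v \<in> cbox 0 1 \<Longrightarrow> 0 \<le> eval \<phi> v \<and> eval \<phi> v \<le> 1"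
  by (induction \<phi>) (auto simp: mem_box_cart)

lemma eval_Oplus: "eval (Oplus \<phi> \<psi>) v = min 1 (eval \<phi> v + eval \<psi> v)"
  by (simp add: Oplus_def)

lemma diff_valuation_order_0:
  "diff_valuation [u] \<longleftrightarrow> u \<in> cbox 0 1"
  by (simp add: diff_valuation_def diff_order_def diff_simplex_def lessThan_Suc)

lemma diff_sat_order_0:
  "u \<in> cbox 0 1 \<Longrightarrow> diff_sat [u] \<psi> \<longleftrightarrow> eval \<psi> u = 1"
  by (auto simp: diff_sat_def diff_simplex_def lessThan_Suc)

context
  fixes \<Theta> :: "'n form set"
begin

lemma d_trans:
  "derives \<Theta> (Imp a b) \<Longrightarrow> derives \<Theta> (Imp b c) \<Longrightarrow> derives \<Theta> (Imp a c)"
  by (rule mp[OF _ mp[OF _ ax2]])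

lemma d_assert: "derives \<Theta> (Imp b (Imp (Imp b c) c))"
  by (rule d_trans[OF ax1 ax3])

lemma d_exch: "derives \<Theta> (Imp (Imp a (Imp b c)) (Imp b (Imp a c)))"
  by (rule d_trans[OF ax2[of \<Theta> a "Imp b c" c] mp[OF d_assert ax2]])

lemma d_exchI: "derives \<Theta> (Imp a (Imp b c)) \<Longrightarrow> derives \<Theta> (Imp b (Imp a c))"
  by (erule mp[OF _ d_exch])

lemma d_refl: "derives \<Theta> (Imp a a)"
  by (rule mp[OF ax1[of \<Theta> a a] d_exchI[OF ax1]])

lemma d_dn1: "derives \<Theta> (Imp (Neg (Neg a)) a)"
proof -
  let ?b = "Imp a a"
  have "derives \<Theta> (Imp (Neg (Neg a)) (Imp ?b a))"
    by (rule d_trans[OF ax1[of _ _ "Neg (Neg ?b)"] d_trans[OF ax4 ax4]])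
  from mp[OF d_refl d_exchI[OF this]] show ?thesis .
qed

lemma d_dn2: "derives \<Theta> (Imp a (Neg (Neg a)))"
  by (rule mp[OF d_dn1 ax4])

lemma d_pre: "derives \<Theta> (Imp a b) \<Longrightarrow> derives \<Theta> (Imp (Imp b c) (Imp a c))"
  by (erule mp[OF _ ax2])

lemma d_post: "derives \<Theta> (Imp b c) \<Longrightarrow> derives \<Theta> (Imp (Imp a b) (Imp a c))"
  by (erule mp[OF _ d_exchI[OF ax2]])

lemma d_contra: "derives \<Theta> (Imp (Imp a b) (Imp (Neg b) (Neg a)))"
  by (rule d_trans[OF d_trans[OF d_pre[OF d_dn1] d_post[OF d_dn2]] ax4])

lemma d_contraI: "derives \<Theta> (Imp a b) \<Longrightarrow> derives \<Theta> (Imp (Neg b) (Neg a))"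
  by (erule mp[OF _ d_contra])

lemma d_neg_imp: "derives \<Theta> (Imp (Neg a) (Imp a b))"
  by (rule d_trans[OF ax1 ax4])

lemma d_swap: "derives \<Theta> (Imp (Imp (Neg a) b) (Imp (Neg b) a))"
  by (rule d_trans[OF d_contra d_post[OF d_dn1]])

lemma derives_Odot: "derives \<Theta> (Odot a b) \<longleftrightarrow> derives \<Theta> a \<and> derives \<Theta> b"
proof
  assume *: "derives \<Theta> (Odot a b)"
  let ?c = "Imp (Neg (Neg a)) (Neg b)"
  have "derives \<Theta> (Imp (Neg ?c) a)"
    by (rule d_trans[OF d_contraI[OF d_exchI[OF d_neg_imp]] d_dn1])
  moreover have "derives \<Theta> (Imp (Neg ?c) b)"
    by (rule d_trans[OF d_contraI[OF ax1] d_dn1])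
  ultimately show "derives \<Theta> a \<and> derives \<Theta> b"
    using mp[OF *[unfolded Odot_def Oplus_def]] by blast
next
  assume *: "derives \<Theta> a \<and> derives \<Theta> b"
  then have "derives \<Theta> (Neg (Neg a))" by (blast intro: mp[OF _ d_dn2])
  then have "derives \<Theta> (Imp (Imp (Neg (Neg a)) (Neg b)) (Neg b))"
    by (rule mp[OF _ d_assert])
  from d_trans[OF d_dn2 d_contraI[OF this]]
  show "derives \<Theta> (Odot a b)" using * unfolding Odot_def Oplus_def by (blast intro: mp)
qed

lemma lind_rel_iff:
  "(a, b) \<in> lind_rel \<Theta> \<longleftrightarrow> derives \<Theta> (Imp a b) \<and> derives \<Theta> (Imp b a)"
  by (simp add: lind_rel_def Equiv_def derives_Odot)

lemma equiv_lind_rel: "equiv UNIV (lind_rel \<Theta>)"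
  by (rule equivI)
    (auto simp: refl_on_def sym_def trans_def lind_rel_iff intro: d_refl d_trans)

lemma lind_rel_Neg: "(a, b) \<in> lind_rel \<Theta> \<Longrightarrow> (Neg a, Neg b) \<in> lind_rel \<Theta>"
  by (auto simp: lind_rel_iff intro: d_contraI)

lemma lind_rel_Imp:
  "(a, b) \<in> lind_rel \<Theta> \<Longrightarrow> (c, d) \<in> lind_rel \<Theta> \<Longrightarrow> (Imp a c, Imp b d) \<in> lind_rel \<Theta>"
  by (auto simp: lind_rel_iff intro: d_trans[OF d_pre d_post])

lemma lind_rel_Oplus:
  "(a, b) \<in> lind_rel \<Theta> \<Longrightarrow> (c, d) \<in> lind_rel \<Theta> \<Longrightarrow> (Oplus a c, Oplus b d) \<in> lind_rel \<Theta>"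
  by (simp add: Oplus_def lind_rel_Imp lind_rel_Neg)

abbreviation (input) cls :: "'n form \<Rightarrow> 'n form set" where
  "cls a \<equiv> lind_rel \<Theta> `` {a}"

lemma cls_eq_iff: "cls a = cls b \<longleftrightarrow> (a, b) \<in> lind_rel \<Theta>"
  using eq_equiv_class_iff[OF equiv_lind_rel] by blast

lemma LIND_carrier: "mv_carrier (LIND \<Theta>) = range cls"
  by (auto simp: LIND_def quotient_def)

lemma LIND_neg: "mv_neg (LIND \<Theta>) (cls a) = cls (Neg a)"
  unfolding LIND_def mv.simps
  by (rule UN_equiv_class[OF equiv_lind_rel])
    (auto simp: congruent_def cls_eq_iff lind_rel_Neg)

lemma LIND_oplus: "mv_oplus (LIND \<Theta>) (cls a) (cls b) = cls (Oplus a b)"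
  unfolding LIND_def mv.simps
  by (rule UN_equiv_class2[OF equiv_lind_rel equiv_lind_rel])
    (auto simp: congruent2_def cls_eq_iff lind_rel_Oplus)

lemma LIND_zero: "mv_zero (LIND \<Theta>) = cls (Neg (Imp a a))"
proof -
  have "derives \<Theta> (Imp (Neg (Imp a a)) \<phi>)" for \<phi>
    by (rule mp[OF d_refl d_exchI[OF d_neg_imp]])
  moreover have "derives \<Theta> (Neg \<phi>) \<longleftrightarrow> derives \<Theta> (Imp \<phi> (Neg (Imp a a)))" for \<phi>
  proof
    show "derives \<Theta> (Imp \<phi> (Neg (Imp a a)))" if "derives \<Theta> (Neg \<phi>)"
      by (rule mp[OF that d_neg_imp])
    show "derives \<Theta> (Neg \<phi>)" if "derives \<Theta> (Imp \<phi> (Neg (Imp a a)))"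
      by (rule mp[OF mp[OF d_refl d_dn2] d_contraI[OF that]])
  qed
  ultimately show ?thesis by (auto simp: LIND_def lind_rel_iff)
qed

lemma LIND_one: "mv_one (LIND \<Theta>) = cls (Imp a a)"
  by (simp add: mv_one_def LIND_zero[of a] LIND_neg cls_eq_iff lind_rel_iff d_dn1 d_dn2)

theorem mv_algebra_LIND: "mv_algebra (LIND \<Theta>)"
proof
  fix x y z
  show "mv_zero (LIND \<Theta>) \<in> mv_carrier (LIND \<Theta>)"
    by (simp add: LIND_carrier LIND_zero[of undefined])
  assume "x \<in> mv_carrier (LIND \<Theta>)"
  then obtain a where x: "x = cls a" by (auto simp: LIND_carrier)
  show "mv_neg (LIND \<Theta>) x \<in> mv_carrier (LIND \<Theta>)"
    by (simp add: x LIND_neg LIND_carrier)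
  show "mv_neg (LIND \<Theta>) (mv_neg (LIND \<Theta>) x) = x"
    by (simp add: x LIND_neg cls_eq_iff lind_rel_iff d_dn1 d_dn2)
  have top: "derives \<Theta> (Imp a (Imp b b))" for a b :: "'n form"
    by (rule mp[OF d_refl ax1])
  have "derives \<Theta> (Imp (Imp (Neg a) (Neg (Imp a a))) a)"
    by (rule d_trans[OF ax4 mp[OF d_refl d_assert]])
  moreover have "derives \<Theta> (Imp a (Imp (Neg a) (Neg (Imp a a))))"
    by (rule d_exchI[OF d_neg_imp])
  ultimately show "mv_oplus (LIND \<Theta>) x (mv_zero (LIND \<Theta>)) = x"
    by (simp add: x LIND_zero[of a] LIND_oplus cls_eq_iff lind_rel_iff Oplus_def)
  show "mv_oplus (LIND \<Theta>) x (mv_one (LIND \<Theta>)) = mv_one (LIND \<Theta>)"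
    using mp[OF top ax1] top
    by (simp add: x LIND_one[of a] LIND_oplus cls_eq_iff lind_rel_iff Oplus_def)
  assume "y \<in> mv_carrier (LIND \<Theta>)"
  then obtain b where y: "y = cls b" by (auto simp: LIND_carrier)
  show "mv_oplus (LIND \<Theta>) x y \<in> mv_carrier (LIND \<Theta>)"
    by (simp add: x y LIND_oplus LIND_carrier)
  show "mv_oplus (LIND \<Theta>) x y = mv_oplus (LIND \<Theta>) y x"
    by (simp add: x y LIND_oplus cls_eq_iff lind_rel_iff Oplus_def d_swap)
  have luk: "derives \<Theta>
      (Imp (Imp (Neg (Neg (Imp (Neg (Neg c)) d))) d) (Imp (Neg (Neg (Imp (Neg (Neg d)) c))) c))"
    for c d :: "'n form"
    by (rule d_trans[OF d_pre[OF d_trans[OF d_pre[OF d_dn1] d_dn2]]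
          d_trans[OF ax3 d_pre[OF d_trans[OF d_dn1 d_pre[OF d_dn2]]]]])
  show "mv_oplus (LIND \<Theta>) (mv_neg (LIND \<Theta>) (mv_oplus (LIND \<Theta>) (mv_neg (LIND \<Theta>) x) y)) y =
        mv_oplus (LIND \<Theta>) (mv_neg (LIND \<Theta>) (mv_oplus (LIND \<Theta>) (mv_neg (LIND \<Theta>) y) x)) x"
    by (simp add: x y LIND_oplus LIND_neg cls_eq_iff lind_rel_iff Oplus_def luk)
  assume "z \<in> mv_carrier (LIND \<Theta>)"
  then obtain c where z: "z = cls c" by (auto simp: LIND_carrier)
  have "derives \<Theta> (Imp (Imp (Neg (Imp (Neg a) b)) c) (Imp (Neg a) (Imp (Neg b) c)))"
    by (rule d_trans[OF d_swap d_trans[OF d_exch d_post[OF d_swap]]])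
  moreover have "derives \<Theta> (Imp (Imp (Neg a) (Imp (Neg b) c)) (Imp (Neg (Imp (Neg a) b)) c))"
    by (rule d_trans[OF d_post[OF d_swap] d_trans[OF d_exch d_swap]])
  ultimately show "mv_oplus (LIND \<Theta>) (mv_oplus (LIND \<Theta>) x y) z =
      mv_oplus (LIND \<Theta>) x (mv_oplus (LIND \<Theta>) y z)"
    by (simp add: x y z LIND_oplus cls_eq_iff lind_rel_iff Oplus_def)
qed

end

end

theory Submission
  imports Defs "HOL-Library.Multiset"
begin

text \<open>
  Everything rests on the completeness of \<open>\<turnstile>\<close> for differential valuations. If \<open>\<Theta>\<close> does not
  derive \<open>\<psi>\<close>, then neither does any finite subset of \<open>\<Theta>\<close>, and finite strong completeness gives
  points \<open>v\<^sub>k\<close> of the cube that satisfy ever larger finite parts of \<open>\<Theta>\<close> but not \<open>\<psi>\<close>. A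
  subsequence has the form \<open>v\<^sub>k = u\<^sub>0 + c\<^sub>1 u\<^sub>1 + \<dots> + c\<^sub>t u\<^sub>t\<close> with orthonormal \<open>u\<^sub>i\<close> and positive
  coefficients each of which is negligible compared with the previous one, so it eventually enters
  every simplex of \<open>U = (u\<^sub>0, \<dots>, u\<^sub>t)\<close>. Truth functions are affine on the simplices with large
  parameter, and an affine function on them has the sign of its first nonzero coefficient; hence
  \<open>U\<close> satisfies exactly what the points satisfy in the limit.

  Finite strong completeness is Chang's argument: a theory maximal among those not deriving \<open>\<psi>\<close>
  has a totally ordered Lindenbaum algebra, which is the unit interval of a totally ordered group,
  and Fourier--Motzkin elimination transfers finitely many linear relations from that group to the
  reals.

  Finally, a maximal ideal of \<open>LIND \<Theta>\<close> is contained in, hence equal to, the ideal of the formulas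
  vanishing at a point satisfying \<open>\<Theta>\<close>, so semisimplicity means that semantic consequence at
  points coincides with derivability.
\<close>

section \<open>MV-algebras and MV-chains\<close>

context mv_algebra
begin

abbreviation carr :: "'a set" where "carr \<equiv> mv_carrier A"
abbreviation plus_A :: "'a \<Rightarrow> 'a \<Rightarrow> 'a" (infixl "\<oplus>" 65) where "x \<oplus> y \<equiv> mv_oplus A x y"
abbreviation neg_A :: "'a \<Rightarrow> 'a" ("\<sim> _" [81] 80) where "\<sim> x \<equiv> mv_neg A x"
abbreviation zero_A :: 'a ("\<zero>") where "\<zero> \<equiv> mv_zero A"
abbreviation one_A :: 'a ("\<one>") where "\<one> \<equiv> mv_one A"
abbreviation le_A :: "'a \<Rightarrow> 'a \<Rightarrow> bool" (infix "\<preceq>" 50) where "x \<preceq> y \<equiv> mv_le A x y"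

text \<open>The Lukasiewicz conjunction; in the unit interval it is
  \<open>max 0 (x + y - 1)\<close>.\<close>

definition odot :: "'a \<Rightarrow> 'a \<Rightarrow> 'a" (infixl "\<odot>" 70) where
  "x \<odot> y = \<sim> (\<sim> x \<oplus> \<sim> y)"

lemma one_closed: "\<one> \<in> carr"
  by (simp add: mv_one_def neg_closed zero_closed)

lemma odot_closed: "x \<in> carr \<Longrightarrow> y \<in> carr \<Longrightarrow> x \<odot> y \<in> carr"
  by (simp add: odot_def neg_closed oplus_closed)

lemmas closed [simp, intro] = zero_closed one_closed neg_closed oplus_closed odot_closed

declare neg_neg [simp] oplus_zero [simp] oplus_one [simp]

lemma neg_one [simp]: "\<sim> \<one> = \<zero>"
  by (simp add: mv_one_def)

lemma neg_zero [simp]: "\<sim> \<zero> = \<one>"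
  by (simp add: mv_one_def)

lemma zero_oplus [simp]: "x \<in> carr \<Longrightarrow> \<zero> \<oplus> x = x"
  by (metis oplus_comm oplus_zero zero_closed)

lemma one_oplus [simp]: "x \<in> carr \<Longrightarrow> \<one> \<oplus> x = \<one>"
  by (metis oplus_comm oplus_one one_closed)

lemma oplus_left_comm:
  "x \<in> carr \<Longrightarrow> y \<in> carr \<Longrightarrow> z \<in> carr \<Longrightarrow> x \<oplus> (y \<oplus> z) = y \<oplus> (x \<oplus> z)"
  by (metis oplus_assoc oplus_comm)

lemma odot_comm: "x \<in> carr \<Longrightarrow> y \<in> carr \<Longrightarrow> x \<odot> y = y \<odot> x"
  by (simp add: odot_def oplus_comm)

lemma odot_assoc:
  "x \<in> carr \<Longrightarrow> y \<in> carr \<Longrightarrow> z \<in> carr \<Longrightarrow> x \<odot> y \<odot> z = x \<odot> (y \<odot> z)"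
  by (simp add: odot_def oplus_assoc)

lemma one_odot: "x \<in> carr \<Longrightarrow> \<one> \<odot> x = x"
  by (simp add: odot_def)

lemma neg_oplus_self: "x \<in> carr \<Longrightarrow> \<sim> x \<oplus> x = \<one>"
  using lukasiewicz[of x \<one>] by simp

lemma le_antisym:
  assumes "x \<in> carr" "y \<in> carr" "x \<preceq> y" "y \<preceq> x" shows "x = y"
  using lukasiewicz[of x y] assms by (simp add: mv_le_def)

text \<open>When \<open>x \<preceq> y\<close>, one side of the Lukasiewicz axiom collapses to
  \<open>y\<close>, and the other exhibits \<open>y\<close> as \<open>x\<close> plus the difference
  \<open>\<sim> x \<odot> y\<close>. Transitivity and monotonicity of the order are read off from
  this.\<close>

lemma le_imp_oplus:
  assumes "x \<in> carr" "y \<in> carr" "x \<preceq> y" shows "y = x \<oplus> \<sim> x \<odot> y"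
  using lukasiewicz[of x y] assms
  by (simp add: mv_le_def odot_def) (metis neg_closed oplus_closed oplus_comm)

lemma le_oplus: assumes "x \<in> carr" "z \<in> carr" shows "x \<preceq> x \<oplus> z"
  using assms by (simp add: mv_le_def neg_oplus_self flip: oplus_assoc)

lemma le_trans:
  assumes "x \<in> carr" "y \<in> carr" "z \<in> carr" "x \<preceq> y" "y \<preceq> z" shows "x \<preceq> z"
proof -
  have "z = x \<oplus> (\<sim> x \<odot> y \<oplus> \<sim> y \<odot> z)"
    using le_imp_oplus[of x y] le_imp_oplus[of y z] assms
    by (metis closed(3,4,5) oplus_assoc)
  then show ?thesis using le_oplus assms by (metis closed(3,4,5))
qed

lemma oplus_mono:
  assumes "x \<in> carr" "y \<in> carr" "z \<in> carr" "x \<preceq> y" shows "x \<oplus> z \<preceq> y \<oplus> z"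
proof -
  have "y \<oplus> z = (x \<oplus> z) \<oplus> \<sim> x \<odot> y"
    using le_imp_oplus[of x y] assms
    by (metis closed(3,4,5) oplus_assoc oplus_comm)
  then show ?thesis using le_oplus assms by (metis closed(3,4,5))
qed

lemma le_neg_iff: "x \<in> carr \<Longrightarrow> y \<in> carr \<Longrightarrow> x \<preceq> \<sim> y \<longleftrightarrow> y \<preceq> \<sim> x"
  by (simp add: mv_le_def) (metis closed(3) oplus_comm)

lemma neg_le_iff: "x \<in> carr \<Longrightarrow> y \<in> carr \<Longrightarrow> \<sim> x \<preceq> y \<longleftrightarrow> x \<oplus> y = \<one>"
  by (simp add: mv_le_def)

lemma neg_antimono: "x \<in> carr \<Longrightarrow> y \<in> carr \<Longrightarrow> x \<preceq> y \<Longrightarrow> \<sim> y \<preceq> \<sim> x"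
  by (simp add: le_neg_iff)

lemma odot_le: assumes "x \<in> carr" "z \<in> carr" shows "x \<odot> z \<preceq> x"
  using le_oplus[of "\<sim> x" "\<sim> z"] assms by (simp add: odot_def le_neg_iff[of _ "x"] flip: le_neg_iff)
    (metis closed(3,4) neg_antimono neg_neg)

lemma odot_mono:
  assumes "x \<in> carr" "y \<in> carr" "z \<in> carr" "x \<preceq> y" shows "x \<odot> z \<preceq> y \<odot> z"
  using assms by (simp add: odot_def neg_antimono oplus_mono)

lemma one_le: "x \<in> carr \<Longrightarrow> \<one> \<preceq> x \<Longrightarrow> x = \<one>"
  by (simp add: mv_le_def)

text \<open>\<open>a \<oplus> x = \<one>\<close> says \<open>\<sim> a \<preceq> x\<close>, so
  \<open>x\<close> is \<open>\<sim> a\<close> plus a difference. That difference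
  \<open>a \<odot> x\<close> is the excess of the sum of \<open>a\<close> and \<open>x\<close> over
  the unit.\<close>

lemma split_complement:
  assumes "a \<in> carr" "x \<in> carr" "a \<oplus> x = \<one>" shows "x = \<sim> a \<oplus> a \<odot> x"
  using le_imp_oplus[of "\<sim> a" x] assms by (simp add: neg_le_iff)

lemma oplus_odot_cancel:
  assumes "a \<in> carr" "x \<in> carr" "a \<preceq> \<sim> x" shows "(a \<oplus> x) \<odot> \<sim> x = a"
  using lukasiewicz[of "\<sim> a" x] assms
  by (simp add: odot_def mv_le_def) (metis closed(3) neg_neg neg_one oplus_comm zero_oplus)

text \<open>With \<open>x\<close> the truncated difference of \<open>a\<close> and \<open>b\<close>,
  and \<open>y\<close> that of \<open>b\<close> and \<open>a\<close>, both
  \<open>x \<oplus> b\<close> and \<open>y \<oplus> a\<close> are the join \<open>c\<close>. Hence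
  \<open>\<sim> y\<close> is \<open>\<sim> c \<oplus> a\<close> and \<open>\<sim> b\<close> is
  \<open>x \<oplus> \<sim> c\<close>, and regrouping gives the claim. Its logical reading is
  \<open>derives_prelinear\<close>.\<close>

lemma prelinear:
  assumes "a \<in> carr" "b \<in> carr"
  shows "\<sim> (\<sim> a \<oplus> b) \<oplus> (\<sim> b \<oplus> a) = \<sim> b \<oplus> a"
proof -
  define x where "x = \<sim> (\<sim> a \<oplus> b)"
  define y where "y = \<sim> (\<sim> b \<oplus> a)"
  define c where "c = x \<oplus> b"
  have carr: "x \<in> carr" "y \<in> carr" "c \<in> carr" using assms by (auto simp: x_def y_def c_def)
  have c2: "c = y \<oplus> a" using lukasiewicz[of a b] assms by (simp add: c_def x_def y_def)
  have "a \<preceq> \<sim> y" using le_oplus[of a "\<sim> b"] assms by (simp add: y_def oplus_comm)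
  then have "y \<preceq> \<sim> a" using carr assms by (simp add: le_neg_iff)
  from oplus_odot_cancel[OF carr(2) assms(1) this]
  have ny: "\<sim> y = \<sim> c \<oplus> a" using carr assms by (simp add: c2 odot_def) (metis closed(3,4) neg_neg)
  have "b \<preceq> \<sim> x" using le_oplus[of b "\<sim> a"] assms by (simp add: x_def oplus_comm)
  then have "x \<preceq> \<sim> b" using carr assms by (simp add: le_neg_iff)
  from oplus_odot_cancel[OF carr(1) assms(2) this]
  have x: "x = c \<odot> \<sim> b" by (simp add: c_def)
  have "b \<preceq> c" using le_oplus[of b x] carr assms by (simp add: c_def oplus_comm)
  then have "x \<oplus> \<sim> c = \<sim> b"
    using lukasiewicz[of "\<sim> b" "\<sim> c"] carr assms
    by (simp add: x odot_def mv_le_def) (metis closed(3) neg_one oplus_comm zero_oplus)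
  then have "x \<oplus> \<sim> y = \<sim> b \<oplus> a"
    using carr assms by (simp add: ny flip: oplus_assoc)
  then show ?thesis using assms by (simp add: x_def y_def)
qed

text \<open>This and the next two identities say that units may be carried in either order in
  Chang's group. Here both sides are the sum of \<open>a\<close>, \<open>x\<close> and
  \<open>y\<close> less one unit, truncated at the unit.\<close>

lemma oplus_odot_exchange:
  assumes "a \<in> carr" "x \<in> carr" "y \<in> carr" "a \<oplus> x = \<one>" "a \<oplus> y = \<one>"
  shows "a \<odot> x \<oplus> y = a \<odot> y \<oplus> x"
proof -
  have "a \<odot> x \<oplus> (\<sim> a \<oplus> a \<odot> y) = a \<odot> y \<oplus> (\<sim> a \<oplus> a \<odot> x)"
    using assms by (metis closed(3,5) oplus_comm oplus_left_comm)
  then show ?thesis using split_complement[of a x] split_complement[of a y] assms by simp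
qed

text \<open>The dual of the previous identity under negation.\<close>

lemma odot_oplus_exchange:
  assumes "a \<in> carr" "x \<in> carr" "y \<in> carr" "a \<preceq> \<sim> x" "a \<preceq> \<sim> y"
  shows "(a \<oplus> x) \<odot> y = (a \<oplus> y) \<odot> x"
  using oplus_odot_exchange[of "\<sim> a" "\<sim> x" "\<sim> y"] assms
  by (simp add: odot_def mv_le_def)

text \<open>No truncation occurs here. With \<open>r\<close> the gap between
  \<open>a \<oplus> x\<close> and the unit, \<open>y\<close> is the sum of \<open>q\<close>,
  \<open>x\<close> and \<open>r\<close>, and \<open>\<odot>\<close> with \<open>\<sim> r\<close>,
  which is \<open>a \<oplus> x\<close>, removes \<open>r\<close> again.\<close>

lemma oplus_odot_assoc:
  assumes "a \<in> carr" "x \<in> carr" "y \<in> carr" "a \<preceq> \<sim> x" "a \<oplus> y = \<one>"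
  shows "(a \<oplus> x) \<odot> y = a \<odot> y \<oplus> x"
proof -
  define q r where "q = a \<odot> y" and "r = \<sim> a \<odot> \<sim> x"
  have carr: "q \<in> carr" "r \<in> carr" using assms by (auto simp: q_def r_def)
  have y: "y = \<sim> a \<oplus> q" using split_complement[of a y] assms by (simp add: q_def)
  have na: "\<sim> a = x \<oplus> r"
    using le_imp_oplus[of x "\<sim> a"] assms by (simp add: le_neg_iff r_def odot_comm)
  have ax: "a \<oplus> x = \<sim> r" using assms by (simp add: r_def odot_def)
  have "q \<oplus> x \<preceq> a \<oplus> x" using odot_le[of a y] oplus_mono[of q a x] assms carr by (simp add: q_def)
  then have "q \<oplus> x \<preceq> \<sim> r" by (simp add: ax)
  from oplus_odot_cancel[OF _ carr(2) this] 
  have "((q \<oplus> x) \<oplus> r) \<odot> \<sim> r = q \<oplus> x" using carr assms by simp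
  moreover have "(q \<oplus> x) \<oplus> r = y" using carr assms by (simp add: y na oplus_assoc oplus_comm oplus_left_comm)
  ultimately have "y \<odot> \<sim> r = q \<oplus> x" by simp
  then show ?thesis using carr assms(1-3) by (simp add: ax odot_comm flip: q_def)
qed

lemma odot_cancel:
  assumes "a \<in> carr" "b \<in> carr" "x \<in> carr" "a \<oplus> x = \<one>" "b \<oplus> x = \<one>" "a \<odot> x = b \<odot> x"
  shows "a = b"
  using split_complement[of x a] split_complement[of x b] assms
  by (simp add: oplus_comm odot_comm)

end

section \<open>Chang's totally ordered group of an MV-chain\<close>

locale mv_chain = mv_algebra +
  assumes total: "x \<in> mv_carrier A \<Longrightarrow> y \<in> mv_carrier A \<Longrightarrow> mv_le A x y \<or> mv_le A y x"
    and zero_neq_one: "mv_zero A \<noteq> mv_one A"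
begin

text \<open>
  The nonnegative part of Chang's totally ordered group: the pair \<open>(m, a)\<close> with \<open>a \<noteq> \<one>\<close>
  stands for \<open>m\<close> units plus \<open>a\<close>, and \<open>add_carry x\<close> is addition of \<open>x\<close>. Outside the carrier
  \<open>add_carry\<close> is the identity, which makes it commute with itself unconditionally.
\<close>

fun add_carry :: "'a \<Rightarrow> nat \<times> 'a \<Rightarrow> nat \<times> 'a" where
  "add_carry x (m, a) =
     (if x \<in> carr \<and> a \<in> carr \<and> a \<noteq> \<one>
      then if a \<oplus> x = \<one> then (Suc m, a \<odot> x) else (m, a \<oplus> x)
      else (m, a))"

definition normal :: "nat \<times> 'a \<Rightarrow> bool" where
  "normal p \<longleftrightarrow> snd p \<in> carr \<and> snd p \<noteq> \<one>"

fun less_carry :: "nat \<times> 'a \<Rightarrow> nat \<times> 'a \<Rightarrow> bool" where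
  "less_carry (m, a) (n, b) \<longleftrightarrow> m < n \<or> m = n \<and> a \<preceq> b \<and> a \<noteq> b"

lemma le_neg_if_oplus_neq_one:
  assumes "a \<in> carr" "x \<in> carr" "a \<oplus> x \<noteq> \<one>" shows "a \<preceq> \<sim> x"
  using total[of a "\<sim> x"] neg_le_iff[of x a] assms by (simp add: oplus_comm)

lemma oplus_cancel:
  assumes "a \<in> carr" "b \<in> carr" "x \<in> carr" "a \<oplus> x = b \<oplus> x" "b \<oplus> x \<noteq> \<one>"
  shows "a = b"
  using oplus_odot_cancel[of a x] oplus_odot_cancel[of b x] le_neg_if_oplus_neq_one assms by metis

lemma odot_neq_one:
  assumes "a \<in> carr" "x \<in> carr" "a \<noteq> \<one>" shows "a \<odot> x \<noteq> \<one>"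
  using odot_le[of a x] assms one_le by auto

lemma normal_add_carry:
  assumes "normal p" shows "normal (add_carry x p)"
  using assms by (cases p) (auto simp: normal_def odot_neq_one)

lemma add_carry_id: "x \<notin> carr \<or> \<not> normal p \<Longrightarrow> add_carry x p = p"
  by (cases p) (auto simp: normal_def)

text \<open>Both orders of addition reach the same normal form. If one summand does not overflow,
  \<open>oplus_odot_assoc\<close> or \<open>odot_oplus_exchange\<close> applies, according to
  whether the other one does; if both overflow, \<open>oplus_odot_exchange\<close> does. This is
  what allows \<open>msum\<close> to be a fold over multisets.\<close>

lemma add_carry_commute: "add_carry y (add_carry x p) = add_carry x (add_carry y p)"
proof (cases "normal p \<and> x \<in> carr \<and> y \<in> carr")
  case True
  obtain m a where p: "p = (m, a)" by force
  have carr: "x \<in> carr" "y \<in> carr" "a \<in> carr" "a \<noteq> \<one>" using True by (auto simp: p normal_def)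
  have half: "add_carry v (add_carry u p) = add_carry u (add_carry v p)"
    if uv: "u \<in> carr" "v \<in> carr" and au: "a \<oplus> u \<noteq> \<one>" for u v
  proof (cases "a \<oplus> v = \<one>")
    case av: True
    have "a \<odot> v \<oplus> u = (a \<oplus> u) \<odot> v"
      using oplus_odot_assoc[of a u v] le_neg_if_oplus_neq_one[of a u] carr uv au av by simp
    moreover have "(a \<oplus> u) \<oplus> v = \<one>"
      using carr uv av by (metis oplus_assoc oplus_comm one_oplus)
    moreover have "(a \<oplus> u) \<odot> v \<noteq> \<one>" using odot_neq_one[of "a \<oplus> u" v] carr uv au by simp
    ultimately show ?thesis using carr uv au av odot_neq_one by (simp add: p)
  next
    case False
    have "(a \<oplus> u) \<odot> v = (a \<oplus> v) \<odot> u"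
      using odot_oplus_exchange[of a u v] le_neg_if_oplus_neq_one carr uv au False by simp
    moreover have "(a \<oplus> u) \<oplus> v = (a \<oplus> v) \<oplus> u" using carr uv by (metis oplus_assoc oplus_comm)
    ultimately show ?thesis using carr uv au False by (simp add: p)
  qed
  consider "a \<oplus> x \<noteq> \<one>" | "a \<oplus> y \<noteq> \<one>" | "a \<oplus> x = \<one>" "a \<oplus> y = \<one>" by blast
  then show ?thesis
  proof cases
    case 3
    have "a \<odot> x \<oplus> y = a \<odot> y \<oplus> x" using oplus_odot_exchange[of a x y] carr 3 by simp
    moreover have "a \<odot> x \<odot> y = a \<odot> y \<odot> x" using carr by (metis odot_assoc odot_comm)
    ultimately show ?thesis using carr 3 odot_neq_one by (simp add: p)
  qed (use half[of x y] half[of y x] carr in simp_all)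
qed (use add_carry_id in metis)

lemma less_carry_linear: "normal p \<Longrightarrow> normal q \<Longrightarrow> less_carry p q \<or> p = q \<or> less_carry q p"
  using total[of "snd p" "snd q"] by (cases p; cases q) (auto simp: normal_def)

lemma less_carry_irrefl: "\<not> less_carry p p"
  by (cases p) simp

lemma less_carry_trans:
  "normal p \<Longrightarrow> normal q \<Longrightarrow> normal r \<Longrightarrow> less_carry p q \<Longrightarrow> less_carry q r \<Longrightarrow> less_carry p r"
  using le_trans[of "snd p" "snd q" "snd r"] le_antisym[of "snd p" "snd q"]
  by (cases p; cases q; cases r) (auto simp: normal_def)

lemma add_carry_strict_mono:
  assumes "normal p" "normal q" "less_carry p q" "x \<in> carr"
  shows "less_carry (add_carry x p) (add_carry x q)"
proof -
  obtain m a n b where p: "p = (m, a)" and q: "q = (n, b)" by force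
  have carr: "a \<in> carr" "a \<noteq> \<one>" "b \<in> carr" "b \<noteq> \<one>" using assms by (auto simp: p q normal_def)
  show ?thesis
  proof (cases "m = n")
    case True
    then have ab: "a \<preceq> b" "a \<noteq> b" using assms by (auto simp: p q)
    have le: "a \<oplus> x \<preceq> b \<oplus> x" "a \<odot> x \<preceq> b \<odot> x"
      using oplus_mono odot_mono carr ab assms by auto
    have "b \<oplus> x = \<one>" if "a \<oplus> x = \<one>" using le(1) one_le[of "b \<oplus> x"] that carr assms by simp
    moreover have "a \<oplus> x \<noteq> b \<oplus> x" if "b \<oplus> x \<noteq> \<one>" using oplus_cancel[of a b x] that carr ab assms by blast
    moreover have "a \<odot> x \<noteq> b \<odot> x" if "a \<oplus> x = \<one>" "b \<oplus> x = \<one>"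
      using odot_cancel[of a b x] that carr ab assms by blast
    ultimately show ?thesis using True carr le assms by (auto simp: p q)
  next
    case False
    then have mn: "m < n" using assms by (auto simp: p q)
    \<comment> \<open>The delicate case is \<open>n = Suc m\<close> with a carry only on the side of
      \<open>a\<close>. The remainders are then compared through \<open>x\<close>; equality would
      give \<open>a \<odot> x = \<one> \<odot> x\<close>, hence \<open>a = \<one>\<close> by
      cancellation.\<close>
    have "a \<odot> x \<preceq> x" using odot_le[of x a] carr assms by (simp add: odot_comm)
    moreover have "x \<preceq> b \<oplus> x" using le_oplus[of x b] carr assms by (simp add: oplus_comm)
    ultimately have le: "a \<odot> x \<preceq> b \<oplus> x" using le_trans[of "a \<odot> x" x "b \<oplus> x"] carr assms by simp
    have "a \<odot> x \<noteq> b \<oplus> x" if ax: "a \<oplus> x = \<one>" "b \<oplus> x \<noteq> \<one>"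
    proof
      assume "a \<odot> x = b \<oplus> x"
      then have "a \<odot> x = \<one> \<odot> x"
        using le_antisym[of "a \<odot> x" x] \<open>a \<odot> x \<preceq> x\<close> \<open>x \<preceq> b \<oplus> x\<close> carr assms by (simp add: one_odot)
      then show False using odot_cancel[of a \<one> x] ax carr assms by simp
    qed
    then show ?thesis using mn le carr assms by (auto simp: p q)
  qed
qed

definition msum :: "'a multiset \<Rightarrow> nat \<times> 'a" where
  "msum M = fold_mset add_carry (0, \<zero>) M"

interpretation add_carry: comp_fun_commute add_carry
  by unfold_locales (auto simp: fun_eq_iff add_carry_commute)

lemma msum_empty [simp]: "msum {#} = (0, \<zero>)"
  by (simp add: msum_def)

lemma msum_add_mset [simp]: "msum (add_mset x M) = add_carry x (msum M)"
  by (simp add: msum_def)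

lemma normal_msum: "normal (msum M)"
  by (induction M) (simp_all add: normal_add_carry, simp add: normal_def zero_neq_one)

lemma msum_mono:
  assumes "set_mset K \<subseteq> carr" "less_carry (msum M) (msum N)"
  shows "less_carry (msum (M + K)) (msum (N + K))"
  using assms by (induction K) (simp_all add: add_carry_strict_mono normal_msum)

lemma msum_cong: "msum M = msum N \<Longrightarrow> msum (M + K) = msum (N + K)"
  by (induction K) simp_all

definition msum_le :: "'a multiset \<Rightarrow> 'a multiset \<Rightarrow> bool" where
  "msum_le M N \<longleftrightarrow> \<not> less_carry (msum N) (msum M)"

lemma msum_le_trans: "msum_le L M \<Longrightarrow> msum_le M N \<Longrightarrow> msum_le L N"
  unfolding msum_le_def
  by (metis less_carry_linear less_carry_trans normal_msum)

lemma msum_le_add: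
  assumes "set_mset M \<subseteq> carr" "set_mset N' \<subseteq> carr" "msum_le M N" "msum_le M' N'"
  shows "msum_le (M + M') (N + N')"
proof -
  have mono: "msum_le (X + K) (Y + K)" if XY: "msum_le X Y" and K: "set_mset K \<subseteq> carr" for X Y K
  proof -
    consider "less_carry (msum X) (msum Y)" | "msum X = msum Y"
      using XY less_carry_linear[of "msum X" "msum Y"] normal_msum by (auto simp: msum_le_def)
    then show ?thesis
    proof cases
      case 1
      from msum_mono[OF K this] show ?thesis
        unfolding msum_le_def using less_carry_irrefl less_carry_trans normal_msum by blast
    next
      case 2
      from msum_cong[OF this] show ?thesis by (simp add: msum_le_def less_carry_irrefl)
    qed
  qed
  have "msum_le (M + M') (M + N')" using mono[OF assms(4,1)] by (simp add: add.commute)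
  then show ?thesis using mono[OF assms(3,2)] msum_le_trans by blast
qed

end

section \<open>Functionals on cones of integer vectors\<close>

lemma submonoid_scale:
  fixes P :: "('i \<Rightarrow> int) set"
  assumes "(\<lambda>_. 0) \<in> P" and "\<And>y z. y \<in> P \<Longrightarrow> z \<in> P \<Longrightarrow> (\<lambda>i. y i + z i) \<in> P" and "z \<in> P"
  shows "(\<lambda>i. int k * z i) \<in> P"
proof (induction k)
  case (Suc k)
  from assms(2)[OF assms(3) this] show ?case by (simp add: algebra_simps)
qed (use assms(1) in simp)

text \<open>The one-variable step of Fourier--Motzkin elimination; the flag of a bound marks it as
  strict. If the largest lower bound equals the smallest upper bound, that value works, because the
  pairwise hypothesis keeps strict bounds away from it; if it is smaller, the midpoint
  works.\<close>

lemma exists_between_finite: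
  fixes L U :: "(real \<times> bool) set"
  assumes "finite L" "finite U"
    and "\<And>l s u t. (l, s) \<in> L \<Longrightarrow> (u, t) \<in> U \<Longrightarrow> l \<le> u \<and> (s \<or> t \<longrightarrow> l < u)"
  shows "\<exists>x. (\<forall>(l, s) \<in> L. l \<le> x \<and> (s \<longrightarrow> l < x)) \<and> (\<forall>(u, t) \<in> U. x \<le> u \<and> (t \<longrightarrow> x < u))"
proof -
  consider "L = {}" "U = {}" | "L = {}" "U \<noteq> {}" | "L \<noteq> {}" "U = {}" | "L \<noteq> {}" "U \<noteq> {}" by blast
  then show ?thesis
  proof cases
    case 1 then show ?thesis by simp
  next
    case 2
    have "Min (fst ` U) - 1 < u" if "(u, t) \<in> U" for u t
      using Min_le[OF finite_imageI[OF assms(2)] imageI[OF that, of fst]] by simp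
    with 2 show ?thesis by (intro exI[of _ "Min (fst ` U) - 1"]) fastforce
  next
    case 3
    have "l < Max (fst ` L) + 1" if "(l, s) \<in> L" for l s
      using Max_ge[OF finite_imageI[OF assms(1)] imageI[OF that, of fst]] by simp
    with 3 show ?thesis by (intro exI[of _ "Max (fst ` L) + 1"]) fastforce
  next
    case 4
    let ?a = "Max (fst ` L)" and ?b = "Min (fst ` U)"
    have a: "l \<le> ?a" if "(l, s) \<in> L" for l s
      using Max_ge[OF finite_imageI[OF assms(1)] imageI[OF that, of fst]] by simp
    have b: "?b \<le> u" if "(u, t) \<in> U" for u t
      using Min_le[OF finite_imageI[OF assms(2)] imageI[OF that, of fst]] by simp
    have "?a \<in> fst ` L" "?b \<in> fst ` U" using 4 assms by (auto intro!: Max_in Min_in)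
    then obtain p q where "p \<in> L" "?a = fst p" "q \<in> U" "?b = fst q" by (elim imageE)
    then have s: "(?a, snd p) \<in> L" and t: "(?b, snd q) \<in> U" by simp_all
    have ab: "?a \<le> ?b" using assms(3)[OF s t] by simp
    show ?thesis
    proof (cases "?a = ?b")
      case True
      have "l \<le> ?a \<and> (s' \<longrightarrow> l < ?a)" if "(l, s') \<in> L" for l s'
        using assms(3)[OF that t] a[OF that] True by auto
      moreover have "?a \<le> u \<and> (t' \<longrightarrow> ?a < u)" if "(u, t') \<in> U" for u t'
        using assms(3)[OF s that] b[OF that] True by auto
      ultimately show ?thesis by (intro exI[of _ ?a]) auto
    next
      case False
      then have lt: "?a < (?a + ?b) / 2" "(?a + ?b) / 2 < ?b" using ab by auto
      have "l < (?a + ?b) / 2" if "(l, s') \<in> L" for l s' using a[OF that] lt by linarith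
      moreover have "(?a + ?b) / 2 < u" if "(u, t') \<in> U" for u t' using b[OF that] lt by linarith
      ultimately show ?thesis by (intro exI[of _ "(?a + ?b) / 2"]) fastforce
    qed
  qed
qed

text \<open>
  Motzkin's transposition theorem for a cone \<open>P\<close> of integer vectors; the proof is
  Fourier--Motzkin elimination of one coordinate at a time.
\<close>

lemma integer_cone_functional:
  fixes P F :: "('i \<Rightarrow> int) set"
  assumes "finite I" "finite F" "F \<subseteq> P"
    and zero: "(\<lambda>_. 0) \<in> P"
    and add: "\<And>y z. y \<in> P \<Longrightarrow> z \<in> P \<Longrightarrow> (\<lambda>i. y i + z i) \<in> P"
    and "\<And>z i. z \<in> F \<Longrightarrow> i \<notin> I \<Longrightarrow> z i = 0"
  shows "\<exists>w :: 'i \<Rightarrow> real. \<forall>z\<in>F. (\<Sum>i\<in>I. w i * z i) \<ge> 0 \<and>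
           ((\<lambda>i. - z i) \<notin> P \<longrightarrow> (\<Sum>i\<in>I. w i * z i) > 0)"
  using assms(1,2,3,6)
proof (induction I arbitrary: F)
  case empty
  have z0: "z = (\<lambda>_. 0)" if "z \<in> F" for z using empty(3)[OF that] by (intro ext) simp
  have "(\<lambda>i. - z i) \<in> P" if "z \<in> F" for z
    unfolding z0[OF that] using zero by simp
  then show ?case by simp
next
  case (insert j I)
  define str where "str z \<longleftrightarrow> (\<lambda>i. - z i) \<notin> P" for z
  \<comment> \<open>For \<open>y\<close> in \<open>Fp\<close> and \<open>z\<close> in
    \<open>Fn\<close> both factors are positive, so this is a combination inside the cone, and its
    coordinate \<open>j\<close> cancels.\<close>
  define elim where "elim y z = (\<lambda>i. - z j * y i + y j * z i)" for y z :: "'i \<Rightarrow> int"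
  define F0 Fp Fn where "F0 = {z\<in>F. z j = 0}" and "Fp = {z\<in>F. z j > 0}" and "Fn = {z\<in>F. z j < 0}"
  define F' where "F' = F0 \<union> (\<lambda>(y, z). elim y z) ` (Fp \<times> Fn)"
  have scale: "(\<lambda>i. k * z i) \<in> P" if "z \<in> P" "k \<ge> 0" for z k
  proof -
    have "(\<lambda>i. int (nat k) * z i) \<in> P" by (rule submonoid_scale) (fact zero add that(1))+
    then show ?thesis using that(2) by simp
  qed
  have elimP: "elim y z \<in> P" if "y \<in> Fp" "z \<in> Fn" for y z
    unfolding elim_def using that insert.prems(2)
    by (intro add scale) (auto simp: Fp_def Fn_def)
  \<comment> \<open>Strictness is inherited because \<open>P\<close> is closed under addition:
    adding \<open>z\<close> to the opposite of \<open>y + z\<close> gives the opposite of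
    \<open>y\<close>, and adding \<open>k - 1\<close> copies of \<open>z\<close> to the opposite of
    \<open>k\<close> times \<open>z\<close> gives the opposite of \<open>z\<close>.\<close>
  have str_add: "str (\<lambda>i. y i + z i)" if "str y" "z \<in> P" for y z
  proof (rule ccontr)
    assume "\<not> ?thesis"
    from add[OF this[unfolded str_def not_not] that(2)] that(1) show False by (simp add: str_def)
  qed
  have str_scale: "str (\<lambda>i. k * z i)" if "str z" "z \<in> P" "k > 0" for z k
  proof (rule ccontr)
    assume "\<not> ?thesis"
    then have "(\<lambda>i. - (k * z i)) \<in> P" by (simp add: str_def)
    from add[OF this scale[OF that(2), of "k - 1"]] that(1,3) show False
      by (simp add: str_def algebra_simps)
  qed
  have str_elim: "str (elim y z)" if yz: "y \<in> Fp" "z \<in> Fn" and s: "str y \<or> str z" for y z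
    using s
  proof
    assume "str y"
    then show ?thesis unfolding elim_def using yz insert.prems(2)
      by (intro str_add str_scale scale) (auto simp: Fp_def Fn_def)
  next
    assume "str z"
    then have "str (\<lambda>i. y j * z i + - z j * y i)" using yz insert.prems(2)
      by (intro str_add str_scale scale) (auto simp: Fp_def Fn_def)
    then show ?thesis unfolding elim_def by (simp add: add.commute)
  qed
  have "finite F'" using insert.prems(1) by (simp add: F'_def F0_def Fp_def Fn_def)
  moreover have "F' \<subseteq> P" using elimP insert.prems(2) by (auto simp: F'_def F0_def)
  moreover have "z i = 0" if "z \<in> F'" "i \<notin> I" for z i
  proof (cases "i = j")
    case True
    then show ?thesis using that by (auto simp: F'_def F0_def elim_def)
  next
    case False
    then have "y i = 0" if "y \<in> F" for y using insert.prems(3)[OF that] \<open>i \<notin> I\<close> by simp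
    then have 0: "\<And>y. y \<in> F0 \<Longrightarrow> y i = 0" "\<And>y. y \<in> Fp \<Longrightarrow> y i = 0" "\<And>y. y \<in> Fn \<Longrightarrow> y i = 0"
      by (auto simp: F0_def Fp_def Fn_def)
    have "elim y y' i = 0" if "y \<in> Fp" "y' \<in> Fn" for y y'
      using 0(2)[OF that(1)] 0(3)[OF that(2)] by (simp add: elim_def)
    then show ?thesis using \<open>z \<in> F'\<close> 0(1) unfolding F'_def by fast
  qed
  ultimately obtain w :: "'i \<Rightarrow> real" where w: "\<And>z. z \<in> F' \<Longrightarrow> (\<Sum>i\<in>I. w i * z i) \<ge> 0"
      "\<And>z. z \<in> F' \<Longrightarrow> str z \<Longrightarrow> (\<Sum>i\<in>I. w i * z i) > 0"
    using insert.IH[of F'] unfolding str_def by blast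
  define S where "S z = (\<Sum>i\<in>I. w i * z i)" for z :: "'i \<Rightarrow> int"
  have S_elim: "S (elim y z) = - z j * S y + y j * S z" for y z
    unfolding S_def elim_def sum_distrib_left sum.distrib[symmetric]
    by (intro sum.cong refl) (simp add: algebra_simps)
  \<comment> \<open>The inequality for \<open>z\<close> bounds the new weight of coordinate
    \<open>j\<close> from below if \<open>z j > 0\<close> and from above if \<open>z j < 0\<close>.
    Compatibility of a lower with an upper bound is the inequality for the corresponding
    \<open>elim y z\<close>.\<close>
  define L U where "L = (\<lambda>y. (- S y / y j, str y)) ` Fp" and "U = (\<lambda>z. (S z / - z j, str z)) ` Fn"
  have "l \<le> u \<and> (s \<or> t \<longrightarrow> l < u)" if lu: "(l, s) \<in> L" "(u, t) \<in> U" for l s u t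
  proof -
    obtain y z where y: "y \<in> Fp" "l = - S y / y j" "s = str y" and z: "z \<in> Fn" "u = S z / - z j" "t = str z"
      using lu unfolding L_def U_def by blast
    have in': "elim y z \<in> F'" using y z by (auto simp: F'_def)
    have sg: "real_of_int (y j) > 0" "real_of_int (z j) < 0" using y z by (auto simp: Fp_def Fn_def)
    have "0 \<le> S (elim y z)" "s \<or> t \<Longrightarrow> 0 < S (elim y z)"
      using w[OF in'] str_elim[OF y(1) z(1)] y z by (auto simp: S_def)
    then have *: "- S y * - z j \<le> S z * y j" "s \<or> t \<Longrightarrow> - S y * - z j < S z * y j"
      unfolding S_elim by (auto simp: algebra_simps)
    have cross: "a / p \<le> b / q \<longleftrightarrow> a * q \<le> b * p" "a / p < b / q \<longleftrightarrow> a * q < b * p"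
      if "p > 0" "q > 0" for a b p q :: real using that by (auto simp: field_simps)
    have "l \<le> u \<longleftrightarrow> - S y * - z j \<le> S z * y j" "l < u \<longleftrightarrow> - S y * - z j < S z * y j"
      unfolding y(2) z(2) by (rule cross; use sg in simp)+
    with * show ?thesis by blast
  qed
  then obtain x where x: "\<forall>(l, s) \<in> L. l \<le> x \<and> (s \<longrightarrow> l < x)" "\<forall>(u, t) \<in> U. x \<le> u \<and> (t \<longrightarrow> x < u)"
    using exists_between_finite[of L U] insert.prems(1)
    by (auto simp: L_def U_def Fp_def Fn_def)
  have sum: "(\<Sum>i\<in>insert j I. (w(j := x)) i * z i) = x * z j + S z" for z :: "'i \<Rightarrow> int"
    using insert.hyps by (simp add: S_def) (intro sum.cong, auto)
  have "x * z j + S z \<ge> 0 \<and> (str z \<longrightarrow> x * z j + S z > 0)" if "z \<in> F" for z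
  proof -
    consider "z j = 0" | "z j > 0" | "z j < 0" by linarith
    then show ?thesis
    proof cases
      case 1
      then show ?thesis using w[of z] that by (auto simp: F'_def F0_def S_def)
    next
      case 2
      then have "(- S z / z j, str z) \<in> L" using that by (auto simp: L_def Fp_def)
      with x(1) have "- S z / z j \<le> x" "str z \<Longrightarrow> - S z / z j < x" by auto
      then show ?thesis using 2 by (auto simp: divide_simps split: if_splits)
    next
      case 3
      then have "(S z / - z j, str z) \<in> U" using that by (auto simp: U_def Fn_def)
      with x(2) have "x \<le> S z / - z j" "str z \<Longrightarrow> x < S z / - z j" by auto
      moreover have "real_of_int (z j) < 0" using 3 by simp
      ultimately show ?thesis by (auto simp: field_simps)
    qed
  qed
  then show ?case unfolding sum[symmetric] str_def by blast
qed

section \<open>Embedding finite parts of MV-chains into the reals\<close>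

lemma sum_count_eq_sum_mset:
  fixes w :: "'a \<Rightarrow> real"
  assumes "finite I" "set_mset M \<subseteq> I"
  shows "(\<Sum>i\<in>I. w i * real (count M i)) = (\<Sum>x\<in>#M. w x)"
  using assms(2)
proof (induction M)
  case (add x M)
  have "(\<Sum>i\<in>I. w i * real (count (add_mset x M) i)) =
      (\<Sum>i\<in>I. w i * real (count M i) + (if i = x then w i else 0))"
    by (intro sum.cong) (auto simp: algebra_simps)
  then show ?case using add assms(1) by (simp add: sum.distrib)
qed simp

context mv_chain
begin

lemma msum_le_iff: "msum_le M N \<longleftrightarrow> msum M = msum N \<or> less_carry (msum M) (msum N)"
  unfolding msum_le_def
  using less_carry_linear less_carry_trans less_carry_irrefl normal_msum by metis

lemma msum_single: "x \<in> carr \<Longrightarrow> msum {#x#} = (if x = \<one> then (1, \<zero>) else (0, x))"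
  using zero_neq_one by (auto simp: odot_def)

lemma msum_pair:
  assumes "x \<in> carr" "y \<in> carr" "x \<oplus> y \<noteq> \<one>" shows "msum {#x, y#} = msum {#x \<oplus> y#}"
  using assms zero_neq_one by (auto simp: oplus_comm)

lemma msum_pair_ge:
  assumes "x \<in> carr" "y \<in> carr" "x \<oplus> y = \<one>" shows "msum_le {#\<one>#} {#x, y#}"
proof -
  have "\<zero> \<preceq> a" if "a \<in> carr" for a using that by (simp add: mv_le_def)
  then show ?thesis using assms zero_neq_one unfolding msum_le_def
    by (auto simp: oplus_comm odot_def le_antisym)
qed

lemma msum_neg: assumes "x \<in> carr" shows "msum {#x, \<sim> x#} = msum {#\<one>#}"
proof -
  have "\<sim> x = \<one> \<Longrightarrow> x = \<zero>" using assms by (metis neg_neg neg_one)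
  moreover have "x \<oplus> \<sim> x = \<one>" using neg_oplus_self[of x] assms by (simp add: oplus_comm)
  ultimately show ?thesis using assms zero_neq_one neg_oplus_self[of x]
    by (auto simp: odot_comm odot_def)
qed

text \<open>
  The integer combinations of elements of the chain that are nonnegative in Chang's group form
  a cone; a functional on it yields values in the reals that respect finitely many relations.
\<close>

lemma chain_functional:
  assumes "finite I" "I \<subseteq> carr"
  obtains w :: "'a \<Rightarrow> real" where
    "\<And>M N. set_mset M \<subseteq> I \<Longrightarrow> set_mset N \<subseteq> I \<Longrightarrow> size M \<le> 2 \<Longrightarrow> size N \<le> 2 \<Longrightarrow>
       msum_le M N \<Longrightarrow> (\<Sum>x\<in>#M. w x) \<le> (\<Sum>x\<in>#N. w x)"
    "\<And>M N. set_mset M \<subseteq> I \<Longrightarrow> set_mset N \<subseteq> I \<Longrightarrow> size M \<le> 2 \<Longrightarrow> size N \<le> 2 \<Longrightarrow>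
       less_carry (msum M) (msum N) \<Longrightarrow> (\<Sum>x\<in>#M. w x) < (\<Sum>x\<in>#N. w x)"
proof -
  define diff where "diff M N = (\<lambda>x. int (count N x) - int (count M x))" for M N :: "'a multiset"
  define P where "P = {z. \<exists>M N. set_mset M \<subseteq> carr \<and> set_mset N \<subseteq> carr \<and> msum_le M N \<and> z = diff M N}"
  \<comment> \<open>Differences of multisets over \<open>I\<close> of size at most two have entries
    between -2 and 2, so only finitely many inequalities are imposed on \<open>w\<close>.\<close>
  define F where "F = P \<inter> {z. \<forall>x. (x \<in> I \<longrightarrow> z x \<in> {-2..2}) \<and> (x \<notin> I \<longrightarrow> z x = 0)}"
  have "finite F" unfolding F_def
    using finite_set_of_finite_funs[OF assms(1), of "{-2..2::int}" 0] by (intro finite_Int) auto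
  have zero: "(\<lambda>_. 0) \<in> P" unfolding P_def
    using msum_le_iff by (auto simp: diff_def fun_eq_iff intro!: exI[of _ "{#}"])
  have add: "(\<lambda>x. y x + z x) \<in> P" if yz: "y \<in> P" "z \<in> P" for y z
  proof -
    obtain M N M' N' where "set_mset M \<subseteq> carr" "set_mset N \<subseteq> carr" "msum_le M N" "y = diff M N"
        "set_mset M' \<subseteq> carr" "set_mset N' \<subseteq> carr" "msum_le M' N'" "z = diff M' N'"
      using yz unfolding P_def by blast
    then have "set_mset (M + M') \<subseteq> carr \<and> set_mset (N + N') \<subseteq> carr \<and> msum_le (M + M') (N + N')
        \<and> (\<lambda>x. y x + z x) = diff (M + M') (N + N')"
      by (auto simp: diff_def fun_eq_iff msum_le_add)
    then show ?thesis unfolding P_def by blast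
  qed
  have "\<exists>w :: 'a \<Rightarrow> real. \<forall>z\<in>F. (\<Sum>i\<in>I. w i * z i) \<ge> 0 \<and>
           ((\<lambda>i. - z i) \<notin> P \<longrightarrow> (\<Sum>i\<in>I. w i * z i) > 0)"
    by (rule integer_cone_functional) (use assms(1) \<open>finite F\<close> zero add in \<open>auto simp: F_def\<close>)
  then obtain w :: "'a \<Rightarrow> real" where w: "\<And>z. z \<in> F \<Longrightarrow> (\<Sum>i\<in>I. w i * z i) \<ge> 0"
      "\<And>z. z \<in> F \<Longrightarrow> (\<lambda>i. - z i) \<notin> P \<Longrightarrow> (\<Sum>i\<in>I. w i * z i) > 0" by blast
  have sum: "(\<Sum>i\<in>I. w i * diff M N i) = (\<Sum>x\<in>#N. w x) - (\<Sum>x\<in>#M. w x)"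
    if "set_mset M \<subseteq> I" "set_mset N \<subseteq> I" for M N
    using sum_count_eq_sum_mset[OF assms(1) that(1), of w] sum_count_eq_sum_mset[OF assms(1) that(2), of w]
    by (simp add: diff_def algebra_simps sum_subtractf)
  have inF: "diff M N \<in> F"
    if M: "set_mset M \<subseteq> I" "size M \<le> 2" and N: "set_mset N \<subseteq> I" "size N \<le> 2" and "msum_le M N" for M N
  proof -
    have "diff M N x \<in> {-2..2}" for x
      using count_le_size[of M x] count_le_size[of N x] M N by (auto simp: diff_def)
    moreover have "diff M N x = 0" if "x \<notin> I" for x
    proof -
      have "x \<notin># M" "x \<notin># N" using M N that by auto
      then show ?thesis by (simp add: diff_def not_in_iff)
    qed
    moreover have "diff M N \<in> P" unfolding P_def using that assms(2) by blast
    ultimately show ?thesis unfolding F_def by blast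
  qed
  \<comment> \<open>If the opposite of \<open>diff M N\<close> were \<open>diff M' N'\<close> with
    \<open>msum_le M' N'\<close>, then \<open>M + M'\<close> and \<open>N + N'\<close> would be the
    same multiset, although the strict inequality makes the sum of the first smaller.\<close>
  have strict: "(\<lambda>x. - diff M N x) \<notin> P" if lt: "less_carry (msum M) (msum N)" and N: "set_mset N \<subseteq> carr" for M N
  proof
    assume "(\<lambda>x. - diff M N x) \<in> P"
    then obtain M' N' where MN: "set_mset M' \<subseteq> carr" "set_mset N' \<subseteq> carr" "msum_le M' N'"
      "(\<lambda>x. - diff M N x) = diff M' N'" unfolding P_def by blast
    have "M + M' = N + N'"
    proof (rule multiset_eqI)
      fix x show "count (M + M') x = count (N + N') x"
        using fun_cong[OF MN(4), of x] by (simp add: diff_def)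
    qed
    moreover have "less_carry (msum (M + M')) (msum (N + M'))" by (rule msum_mono[OF MN(1) lt])
    moreover have "msum_le (M' + N) (N' + N)"
      using msum_le_add[OF MN(1) N MN(3)] by (simp add: msum_le_iff)
    ultimately show False unfolding msum_le_def by (simp add: add.commute)
  qed
  show ?thesis
  proof (rule that[of w])
    fix M N assume MN: "set_mset M \<subseteq> I" "set_mset N \<subseteq> I" "size M \<le> 2" "size N \<le> 2"
    show "(\<Sum>x\<in>#M. w x) \<le> (\<Sum>x\<in>#N. w x)" if "msum_le M N"
      using w(1)[OF inF[OF MN(1,3,2,4) that]] sum[OF MN(1,2)] by simp
    show "(\<Sum>x\<in>#M. w x) < (\<Sum>x\<in>#N. w x)" if "less_carry (msum M) (msum N)"
      using w(2)[OF inF[OF MN(1,3,2,4)] strict[OF that]] that sum[OF MN(1,2)] MN(2) assms(2)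
      by (auto simp: msum_le_iff)
  qed
qed

text \<open>\<open>h\<close> is the functional of \<open>chain_functional\<close>, divided by the
  weight of the unit. A sum \<open>x \<oplus> y\<close> other than \<open>\<one>\<close> is the
  exact sum in Chang's group, and otherwise the exact sum is at least one unit; both facts, as well
  as the one on negation, compare multisets of size at most two. The strict inequalities make the
  divisor positive and keep every element other than \<open>\<one>\<close> below 1.\<close>

lemma partial_embedding:
  assumes "finite I" "I \<subseteq> carr"
  obtains h :: "'a \<Rightarrow> real" where
    "h \<one> = 1"
    "\<And>x. x \<in> I \<Longrightarrow> 0 \<le> h x \<and> h x \<le> 1"
    "\<And>x. x \<in> I \<Longrightarrow> x \<noteq> \<one> \<Longrightarrow> h x < 1"
    "\<And>x y. x \<in> I \<Longrightarrow> y \<in> I \<Longrightarrow> x \<oplus> y \<in> I \<Longrightarrow> h (x \<oplus> y) = min 1 (h x + h y)"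
    "\<And>x. x \<in> I \<Longrightarrow> \<sim> x \<in> I \<Longrightarrow> h (\<sim> x) = 1 - h x"
proof -
  have "finite (insert \<one> I)" "insert \<one> I \<subseteq> carr" using assms by auto
  from chain_functional[OF this] obtain w :: "'a \<Rightarrow> real" where
    le: "\<And>M N. set_mset M \<subseteq> insert \<one> I \<Longrightarrow> set_mset N \<subseteq> insert \<one> I \<Longrightarrow> size M \<le> 2 \<Longrightarrow> size N \<le> 2 \<Longrightarrow>
       msum_le M N \<Longrightarrow> (\<Sum>x\<in>#M. w x) \<le> (\<Sum>x\<in>#N. w x)" and
    less: "\<And>M N. set_mset M \<subseteq> insert \<one> I \<Longrightarrow> set_mset N \<subseteq> insert \<one> I \<Longrightarrow> size M \<le> 2 \<Longrightarrow> size N \<le> 2 \<Longrightarrow>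
       less_carry (msum M) (msum N) \<Longrightarrow> (\<Sum>x\<in>#M. w x) < (\<Sum>x\<in>#N. w x)" by blast
  have eq: "(\<Sum>x\<in>#M. w x) = (\<Sum>x\<in>#N. w x)"
    if "set_mset M \<subseteq> insert \<one> I" "set_mset N \<subseteq> insert \<one> I" "size M \<le> 2" "size N \<le> 2" "msum M = msum N" for M N
    using le[of M N] le[of N M] that by (simp add: msum_le_iff)
  have pos: "w \<one> > 0" using less[of "{#}" "{#\<one>#}"] by (simp add: msum_single del: msum_add_mset)
  have ge0: "w x \<ge> 0" if "x \<in> I" for x
  proof -
    have "\<zero> \<preceq> x" using assms that by (auto simp: mv_le_def)
    then show ?thesis using le[of "{#}" "{#x#}"] that assms
      by (auto simp: msum_le_iff msum_single simp del: msum_add_mset)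
  qed
  have lt1: "w x < w \<one>" if "x \<in> I" "x \<noteq> \<one>" for x
    using less[of "{#x#}" "{#\<one>#}"] that assms
    by (auto simp: msum_le_iff msum_single simp del: msum_add_mset)
  have le1: "w x \<le> w \<one>" if "x \<in> I" for x using lt1[of x] that by fastforce
  show ?thesis
  proof (rule that[of "\<lambda>x. w x / w \<one>"])
    show "w \<one> / w \<one> = 1" using pos by simp
    show "0 \<le> w x / w \<one> \<and> w x / w \<one> \<le> 1" if "x \<in> I" for x
      using ge0[OF that] le1[OF that] pos by simp
    show "w x / w \<one> < 1" if "x \<in> I" "x \<noteq> \<one>" for x
      using lt1[OF that] pos by simp
    show "w (\<sim> x) / w \<one> = 1 - w x / w \<one>" if "x \<in> I" "\<sim> x \<in> I" for x
      using eq[of "{#x, \<sim> x#}" "{#\<one>#}"] that assms pos msum_neg[of x]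
      by (auto simp: field_simps simp del: msum_add_mset)
    show "w (x \<oplus> y) / w \<one> = min 1 (w x / w \<one> + w y / w \<one>)" if xy: "x \<in> I" "y \<in> I" "x \<oplus> y \<in> I" for x y
    proof (cases "x \<oplus> y = \<one>")
      case True
      then have "w \<one> \<le> w x + w y"
        using le[of "{#\<one>#}" "{#x, y#}"] msum_pair_ge[of x y] xy assms by (auto simp del: msum_add_mset)
      then show ?thesis using True pos by (simp add: min_def field_simps)
    next
      case False
      then have "w (x \<oplus> y) = w x + w y"
        using eq[of "{#x, y#}" "{#x \<oplus> y#}"] msum_pair[OF _ _ False] xy assms(2) by (simp add: subset_eq del: msum_add_mset)
      then show ?thesis using le1[OF xy(3)] pos by (simp add: min_def field_simps)
    qed
  qed
qed

end

section \<open>Finite strong completeness\<close>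

lemma derives_mono: "derives \<Theta> \<phi> \<Longrightarrow> \<Theta> \<subseteq> \<Gamma> \<Longrightarrow> derives \<Gamma> \<phi>"
proof (induction rule: derives.induct)
  case (mp \<phi> \<psi>)
  then show ?case by (intro derives.mp[of \<Gamma> \<phi> \<psi>])
qed (auto intro: derives.hyp derives.ax1 derives.ax2 derives.ax3 derives.ax4)

lemma derives_finite: "derives \<Theta> \<phi> \<Longrightarrow> \<exists>\<Theta>0. finite \<Theta>0 \<and> \<Theta>0 \<subseteq> \<Theta> \<and> derives \<Theta>0 \<phi>"
proof (induction rule: derives.induct)
  case (hyp \<phi>)
  then show ?case by (intro exI[of _ "{\<phi>}"]) (auto intro: derives.hyp)
next
  case (mp \<phi> \<psi>)
  then obtain \<Delta> \<Delta>' where "finite \<Delta>" "\<Delta> \<subseteq> \<Theta>" "derives \<Delta> \<phi>" "finite \<Delta>'" "\<Delta>' \<subseteq> \<Theta>" "derives \<Delta>' (Imp \<phi> \<psi>)"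
    by blast
  then show ?case
    using derives.mp[of "\<Delta> \<union> \<Delta>'" \<phi> \<psi>] derives_mono[of \<Delta> \<phi>] derives_mono[of \<Delta>' "Imp \<phi> \<psi>"]
    by (intro exI[of _ "\<Delta> \<union> \<Delta>'"]) simp
qed (rule exI[of _ "{}"], simp add: derives.ax1 derives.ax2 derives.ax3 derives.ax4)+

text \<open>The lattice join: on the unit cube its truth value is the maximum of the two truth
  values.\<close>

definition Or :: "'n form \<Rightarrow> 'n form \<Rightarrow> 'n form" where
  "Or \<phi> \<psi> = Imp (Imp \<phi> \<psi>) \<psi>"

lemma derives_Or_commute: "derives \<Theta> (Or a b) \<Longrightarrow> derives \<Theta> (Or b a)"
  unfolding Or_def by (rule mp[OF _ ax3])

lemma derives_Or_elim:
  assumes "derives \<Theta> (Or a b)" "derives \<Theta> (Imp a c)" "derives \<Theta> (Imp b c)"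
  shows "derives \<Theta> c"
proof -
  have "derives \<Theta> (Imp (Or a b) (Imp (Imp b c) c))"
    unfolding Or_def by (rule d_trans[OF d_pre[OF d_pre[OF assms(2)]] ax3])
  then show ?thesis using assms(1,3) mp by blast
qed

text \<open>Modus ponens under a side disjunct \<open>q\<close>. Each of \<open>c\<close> and
  \<open>q\<close> implies \<open>Imp (Imp q d) d\<close>, which is \<open>Or q d\<close>.\<close>

lemma derives_Or_mp:
  assumes "derives \<Theta> (Or c q)" "derives \<Theta> (Or (Imp c d) q)"
  shows "derives \<Theta> (Or d q)"
proof -
  let ?r = "Imp q d"
  have "derives \<Theta> (Imp ?r (Imp c d))"
    by (rule d_trans[OF ax1 d_trans[OF d_exch derives_Or_commute[OF assms(2), unfolded Or_def]]])
  from derives_Or_elim[OF assms(1) d_exchI[OF this] d_assert]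
  have "derives \<Theta> (Or q d)" by (simp add: Or_def)
  then show ?thesis by (rule derives_Or_commute)
qed

text \<open>A substitute for the deduction theorem, which fails in its classical form for lack of
  contraction: an extra hypothesis \<open>p\<close> is paid for with the disjunct \<open>q\<close>,
  which is carried along the whole derivation.\<close>

lemma derives_Or_left:
  assumes "derives (insert p \<Theta>) c" "derives \<Theta> (Or p q)"
  shows "derives \<Theta> (Or c q)"
proof -
  have Or: "derives \<Theta> \<phi> \<Longrightarrow> derives \<Theta> (Or \<phi> q)" for \<phi>
    unfolding Or_def by (rule mp[OF _ d_assert])
  show ?thesis using assms(1)
    by (induction rule: derives.induct)
      (auto intro: Or derives.hyp derives.ax1 derives.ax2 derives.ax3 derives.ax4 assms(2) derives_Or_mp)
qed

lemma derives_cases: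
  assumes "derives \<Theta> (Or p q)" "derives (insert p \<Theta>) c" "derives (insert q \<Theta>) c"
  shows "derives \<Theta> c"
proof -
  have "derives \<Theta> (Or c c)"
    by (rule derives_Or_left[OF assms(3) derives_Or_commute[OF derives_Or_left[OF assms(2,1)]]])
  then show ?thesis unfolding Or_def by (rule mp[OF d_refl])
qed

section \<open>Theories whose Lindenbaum algebra is a chain\<close>

lemma LIND_Imp_cls:
  "lind_rel \<Theta> `` {Imp a b} = mv_oplus (LIND \<Theta>) (mv_neg (LIND \<Theta>) (lind_rel \<Theta> `` {a})) (lind_rel \<Theta> `` {b})"
  unfolding LIND_neg LIND_oplus cls_eq_iff Oplus_def
  by (rule lind_rel_Imp) (simp_all add: lind_rel_iff d_refl d_dn1 d_dn2)

lemma LIND_cls_eq_one: "lind_rel \<Theta> `` {a} = mv_one (LIND \<Theta>) \<longleftrightarrow> derives \<Theta> a"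
proof -
  have "derives \<Theta> (Imp a (Imp a a))" by (rule mp[OF d_refl ax1])
  moreover have "derives \<Theta> (Imp (Imp a a) a) \<longleftrightarrow> derives \<Theta> a" by (blast intro: mp[OF d_refl] mp[OF _ ax1])
  ultimately show ?thesis by (simp add: LIND_one[of _ a] cls_eq_iff lind_rel_iff)
qed

lemma LIND_le_iff:
  "mv_le (LIND \<Theta>) (lind_rel \<Theta> `` {a}) (lind_rel \<Theta> `` {b}) \<longleftrightarrow> derives \<Theta> (Imp a b)"
  unfolding mv_le_def LIND_Imp_cls[symmetric] by (rule LIND_cls_eq_one)

lemma derives_prelinear: "derives \<Theta> (Or (Imp a b) (Imp b a))"
proof -
  interpret mv_algebra "LIND \<Theta>" by (rule mv_algebra_LIND)
  let ?c = "\<lambda>\<phi>. lind_rel \<Theta> `` {\<phi>}"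
  have carr: "?c \<phi> \<in> mv_carrier (LIND \<Theta>)" for \<phi> by (simp add: LIND_carrier)
  have "?c (Imp (Imp a b) (Imp b a)) = ?c (Imp b a)"
    unfolding LIND_Imp_cls by (rule prelinear) (rule carr)+
  then show ?thesis by (simp add: Or_def cls_eq_iff lind_rel_iff)
qed

text \<open>Zorn's lemma applies because derivations are finite. If a maximal
  \<open>\<Gamma>\<close> derived neither implication, adding either one would yield
  \<open>\<psi>\<close>, and \<open>derives_cases\<close> applied to
  \<open>derives_prelinear\<close> would yield \<open>\<psi>\<close> from \<open>\<Gamma>\<close>
  itself.\<close>

lemma prime_extension:
  assumes "\<not> derives \<Theta> \<psi>"
  obtains \<Gamma> where "\<Theta> \<subseteq> \<Gamma>" "\<not> derives \<Gamma> \<psi>" "\<And>a b. derives \<Gamma> (Imp a b) \<or> derives \<Gamma> (Imp b a)"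
proof -
  let ?S = "{\<Gamma>. \<Theta> \<subseteq> \<Gamma> \<and> \<not> derives \<Gamma> \<psi>}"
  have "\<Union>C \<in> ?S" if "C \<noteq> {}" "subset.chain ?S C" for C
  proof -
    have sub: "C \<subseteq> ?S" using that(2) by (simp add: subset.chain_def)
    have "\<not> derives (\<Union>C) \<psi>"
    proof
      assume "derives (\<Union>C) \<psi>"
      then obtain \<Delta> where D: "finite \<Delta>" "\<Delta> \<subseteq> \<Union>C" "derives \<Delta> \<psi>" using derives_finite by blast
      from finite_subset_Union_chain[OF D(1,2) that] obtain \<Gamma> where "\<Gamma> \<in> C" "\<Delta> \<subseteq> \<Gamma>" .
      then show False using derives_mono[OF D(3)] sub by blast
    qed
    moreover have "\<Theta> \<subseteq> \<Union>C" using sub that(1) by auto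
    ultimately show ?thesis by simp
  qed
  moreover have "?S \<noteq> {}" using assms by auto
  ultimately have "\<exists>M\<in>?S. \<forall>X\<in>?S. M \<subseteq> X \<longrightarrow> X = M" by (intro subset_Zorn_nonempty)
  then obtain \<Gamma> where G: "\<Gamma> \<in> ?S" and max: "\<And>X. X \<in> ?S \<Longrightarrow> \<Gamma> \<subseteq> X \<Longrightarrow> X = \<Gamma>" by auto
  have ins: "derives (insert p \<Gamma>) \<psi>" if "\<not> derives \<Gamma> p" for p
  proof (rule ccontr)
    assume "\<not> derives (insert p \<Gamma>) \<psi>"
    then have "insert p \<Gamma> = \<Gamma>" using G by (intro max) auto
    then show False using that hyp[of p \<Gamma>] by auto
  qed
  have "derives \<Gamma> (Imp a b) \<or> derives \<Gamma> (Imp b a)" for a b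
    using derives_cases[OF derives_prelinear[of \<Gamma> a b] ins ins] G by auto
  then show ?thesis using G by (intro that[of \<Gamma>]) auto
qed

lemma mv_chain_LIND:
  assumes "\<not> derives \<Gamma> \<psi>" "\<And>a b. derives \<Gamma> (Imp a b) \<or> derives \<Gamma> (Imp b a)"
  shows "mv_chain (LIND \<Gamma>)"
proof -
  let ?L = "LIND \<Gamma>"
  interpret mv_algebra ?L by (rule mv_algebra_LIND)
  show ?thesis
  proof
    show "mv_le ?L x y \<or> mv_le ?L y x" if xy: "x \<in> mv_carrier ?L" "y \<in> mv_carrier ?L" for x y
    proof -
      obtain a b where "x = lind_rel \<Gamma> `` {a}" "y = lind_rel \<Gamma> `` {b}" using xy by (auto simp: LIND_carrier)
      then show ?thesis using assms(2)[of a b] by (simp add: LIND_le_iff)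
    qed
    show "mv_zero ?L \<noteq> mv_one ?L"
    proof
      assume "mv_zero ?L = mv_one ?L"
      then have "mv_le ?L (mv_one ?L) (lind_rel \<Gamma> `` {\<psi>})" by (simp add: mv_le_def LIND_carrier)
      then have "lind_rel \<Gamma> `` {\<psi>} = mv_one ?L" by (intro one_le) (auto simp: LIND_carrier)
      then show False using assms(1) by (simp add: LIND_cls_eq_one)
    qed
  qed
qed

primrec subforms :: "'n form \<Rightarrow> 'n form set" where
  "subforms (Var i) = {Var i}"
| "subforms (Neg \<phi>) = insert (Neg \<phi>) (subforms \<phi>)"
| "subforms (Imp \<phi> \<psi>) = insert (Imp \<phi> \<psi>) (subforms \<phi> \<union> subforms \<psi>)"

lemma finite_subforms: "finite (subforms \<phi>)"
  by (induction \<phi>) auto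

lemma self_in_subforms: "\<phi> \<in> subforms \<phi>"
  by (cases \<phi>) auto

lemma subforms_trans: "\<gamma> \<in> subforms \<phi> \<Longrightarrow> subforms \<gamma> \<subseteq> subforms \<phi>"
  by (induction \<phi>) auto

text \<open>In the Lindenbaum chain of a prime extension, hypotheses have class one and
  \<open>\<psi>\<close> does not. Only finitely many classes occur in evaluating the given formulas,
  and a partial embedding of these into the unit interval, restricted to variables, is the required
  valuation.\<close>

lemma finite_completeness:
  fixes \<Theta> :: "'n::finite form set"
  assumes "finite \<Theta>" "\<not> derives \<Theta> \<psi>"
  obtains v where "v \<in> cbox 0 1" "\<And>\<theta>. \<theta> \<in> \<Theta> \<Longrightarrow> eval \<theta> v = 1" "eval \<psi> v < 1"
proof -
  obtain \<Gamma> where G: "\<Theta> \<subseteq> \<Gamma>" "\<not> derives \<Gamma> \<psi>" "\<And>a b. derives \<Gamma> (Imp a b) \<or> derives \<Gamma> (Imp b a)"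
    using prime_extension[OF assms(2)] by blast
  let ?L = "LIND \<Gamma>"
  interpret mv_chain ?L by (rule mv_chain_LIND[OF G(2,3)])
  define c where "c \<phi> = lind_rel \<Gamma> `` {\<phi>}" for \<phi>
  \<comment> \<open>All variables are included, also those that do not occur in the formulas, so
    that every coordinate of \<open>v\<close> lies in the unit interval.\<close>
  define S where "S = range Var \<union> (\<Union>\<phi>\<in>insert \<psi> \<Theta>. subforms \<phi>)"
  \<comment> \<open>The negations are added because an implication is computed in the algebra as
    \<open>\<oplus>\<close> of a negated class and a class, and \<open>h\<close> respects
    \<open>\<oplus>\<close> only when the arguments and the result lie in \<open>I\<close>.\<close>
  define I where "I = c ` (S \<union> Neg ` S)"
  have "finite I" using assms(1) by (simp add: I_def S_def finite_subforms)
  moreover have "I \<subseteq> mv_carrier ?L" by (auto simp: I_def c_def LIND_carrier)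
  ultimately obtain h :: "'n form set \<Rightarrow> real" where h: "h (mv_one ?L) = 1"
    "\<And>x. x \<in> I \<Longrightarrow> 0 \<le> h x \<and> h x \<le> 1"
    "\<And>x. x \<in> I \<Longrightarrow> x \<noteq> mv_one ?L \<Longrightarrow> h x < 1"
    "\<And>x y. x \<in> I \<Longrightarrow> y \<in> I \<Longrightarrow> mv_oplus ?L x y \<in> I \<Longrightarrow> h (mv_oplus ?L x y) = min 1 (h x + h y)"
    "\<And>x. x \<in> I \<Longrightarrow> mv_neg ?L x \<in> I \<Longrightarrow> h (mv_neg ?L x) = 1 - h x"
    using partial_embedding by blast
  define v where "v = (\<chi> i. h (c (Var i)))"
  have neg: "c (Neg \<phi>) = mv_neg ?L (c \<phi>)" and imp: "c (Imp \<phi> \<gamma>) = mv_oplus ?L (mv_neg ?L (c \<phi>)) (c \<gamma>)" for \<phi> \<gamma>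
    by (simp_all add: c_def LIND_neg LIND_Imp_cls)
  have inI: "c \<phi> \<in> I" "mv_neg ?L (c \<phi>) \<in> I" if "\<phi> \<in> S" for \<phi>
    using that by (auto simp: I_def simp flip: neg)
  have S_sub: "\<gamma> \<in> S" if phi: "\<phi> \<in> S" and "\<gamma> \<in> subforms \<phi>" for \<phi> \<gamma>
  proof (cases "\<phi> \<in> range Var")
    case False
    then obtain \<delta> where "\<delta> \<in> insert \<psi> \<Theta>" "\<phi> \<in> subforms \<delta>" using phi by (auto simp: S_def)
    then have "\<gamma> \<in> subforms \<delta>" using subforms_trans[of \<phi> \<delta>] that(2) by blast
    then show ?thesis using \<open>\<delta> \<in> insert \<psi> \<Theta>\<close> by (auto simp: S_def)
  qed (use that in \<open>auto simp: S_def\<close>)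
  have eval: "\<phi> \<in> S \<Longrightarrow> eval \<phi> v = h (c \<phi>)" for \<phi>
  proof (induction \<phi>)
    case (Var i)
    then show ?case by (simp add: v_def)
  next
    case (Neg \<phi>)
    then have "\<phi> \<in> S" using S_sub[OF Neg.prems] self_in_subforms by auto
    then show ?case using Neg.IH h(5)[OF inI] by (simp add: neg)
  next
    case (Imp \<phi> \<gamma>)
    then have sub: "\<phi> \<in> S" "\<gamma> \<in> S" using S_sub[OF Imp.prems] self_in_subforms by auto
    have "h (mv_oplus ?L (mv_neg ?L (c \<phi>)) (c \<gamma>)) = min 1 (h (mv_neg ?L (c \<phi>)) + h (c \<gamma>))"
      using h(4)[of "mv_neg ?L (c \<phi>)" "c \<gamma>"] inI sub inI(1)[OF Imp.prems] by (simp add: imp)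
    then show ?case using Imp.IH sub h(5)[OF inI[OF sub(1)]] by (simp add: imp)
  qed
  have S: "insert \<psi> \<Theta> \<subseteq> S" using self_in_subforms by (auto simp: S_def)
  show ?thesis
  proof (rule that[of v])
    show "v \<in> cbox 0 1" using h(2)[OF inI(1)] by (auto simp: mem_box_cart v_def S_def)
    show "eval \<theta> v = 1" if "\<theta> \<in> \<Theta>" for \<theta>
    proof -
      have "c \<theta> = mv_one ?L" using G(1) that hyp[of \<theta> \<Gamma>] by (auto simp: c_def LIND_cls_eq_one)
      then show ?thesis using eval[of \<theta>] S that h(1) by auto
    qed
    show "eval \<psi> v < 1"
      using eval[of \<psi>] S h(3)[OF inI(1), of \<psi>] G(2) by (auto simp: c_def LIND_cls_eq_one)
  qed
qed

section \<open>Simplices of differential valuations\<close>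

text \<open>An asymptotic expansion of the sequence \<open>e\<close> along orthonormal directions,
  each coefficient being infinitely small compared with the one before. The subspace
  \<open>S\<close> is a parameter for the sake of induction on its dimension; the length bound
  becomes the bound on the order of a differential valuation.\<close>

definition flag_expansion ::
    "'a::euclidean_space set \<Rightarrow> (nat \<Rightarrow> 'a) \<Rightarrow> 'a list \<Rightarrow> (nat \<Rightarrow> nat \<Rightarrow> real) \<Rightarrow> bool" where
  "flag_expansion S e us c \<longleftrightarrow> length us \<le> dim S \<and> set us \<subseteq> S \<and>
    (\<forall>i<length us. norm (us ! i) = 1) \<and>
    (\<forall>i<length us. \<forall>j<length us. i \<noteq> j \<longrightarrow> orthogonal (us ! i) (us ! j)) \<and>
    (\<forall>k. e k = (\<Sum>i<length us. c k i *\<^sub>R us ! i)) \<and>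
    (\<forall>k. \<forall>i<length us. c k i > 0) \<and>
    (\<forall>i. Suc i < length us \<longrightarrow> (\<lambda>k. c k (Suc i) / c k i) \<longlonglongrightarrow> 0)"

lemma flag_expansionD:
  assumes "flag_expansion S e us c"
  shows "length us \<le> dim S" "set us \<subseteq> S"
    "\<And>i. i < length us \<Longrightarrow> norm (us ! i) = 1"
    "\<And>i j. i < length us \<Longrightarrow> j < length us \<Longrightarrow> i \<noteq> j \<Longrightarrow> orthogonal (us ! i) (us ! j)"
    "\<And>k. e k = (\<Sum>i<length us. c k i *\<^sub>R us ! i)"
    "\<And>k i. i < length us \<Longrightarrow> c k i > 0"
    "\<And>i. Suc i < length us \<Longrightarrow> (\<lambda>k. c k (Suc i) / c k i) \<longlonglongrightarrow> 0"
  using assms unfolding flag_expansion_def by simp_all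

lemma flag_expansion_hd_le_norm:
  assumes fe: "flag_expansion S e us c" and "us \<noteq> []"
  shows "c k 0 \<le> norm (e k)"
proof -
  note fe = flag_expansionD[OF fe]
  have "e k \<bullet> us ! 0 = (\<Sum>i<length us. if i = 0 then c k 0 else 0)"
    unfolding fe(5) inner_sum_left using assms(2) fe(3)[of 0] fe(4)[of _ 0]
    by (intro sum.cong) (auto simp: orthogonal_def norm_eq_1)
  also have "\<dots> = c k 0" using assms(2) by simp
  finally show ?thesis
    using Cauchy_Schwarz_ineq2[of "e k" "us ! 0"] fe(3)[of 0] assms(2) by simp
qed

text \<open>Directions are peeled off one at a time, by induction on the dimension. If infinitely
  many terms vanish, the empty list works along them. Otherwise a limit \<open>u\<close> of the
  normalised terms is the leading direction; the remainder \<open>h\<close> is negligible compared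
  with the removed coefficient \<open>a\<close>, and it lies in the part of \<open>S\<close>
  orthogonal to \<open>u\<close>, which has smaller dimension.\<close>

lemma flag_expansion_exists:
  fixes e :: "nat \<Rightarrow> 'a::euclidean_space"
  assumes "subspace S" "\<And>k. e k \<in> S"
  shows "\<exists>r us c. strict_mono (r :: nat \<Rightarrow> nat) \<and> flag_expansion S (e \<circ> r) us c"
  using assms
proof (induction "dim S" arbitrary: S e rule: less_induct)
  case less
  show ?case
  proof (cases "infinite {k. e k = 0}")
    case True
    then show ?thesis
      using strict_mono_enumerate[OF True] enumerate_in_set[OF True]
      by (intro exI[of _ "enumerate {k. e k = 0}"] exI[of _ "[]"]) (auto simp: flag_expansion_def)
  next
    case False
    then obtain N where N: "\<And>k. e k = 0 \<Longrightarrow> k < N"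
      unfolding not_not finite_nat_set_iff_bounded by auto
    define y where "y k = e (k + N) /\<^sub>R norm (e (k + N))" for k
    have nz: "e (k + N) \<noteq> 0" for k using N[of "k + N"] by auto
    have "y k \<in> sphere 0 1" for k using nz[of k] by (simp add: y_def)
    then obtain u r1 where u: "u \<in> sphere 0 1" and r1: "strict_mono r1" and lim: "(y \<circ> r1) \<longlonglongrightarrow> u"
      using compact_sphere[of 0 1] unfolding compact_def by metis
    have uu: "u \<bullet> u = 1" using u by (simp add: norm_eq_1)
    have "u \<in> S"
    proof (rule closed_sequentially[OF closed_subspace[OF less.prems(1)] _ lim])
      show "(y \<circ> r1) k \<in> S" for k using less.prems by (simp add: y_def subspace_scale)
    qed
    have lim1: "(\<lambda>k. (y \<circ> r1) k \<bullet> u) \<longlonglongrightarrow> 1"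
      using tendsto_inner[OF lim tendsto_const[of u]] uu by simp
    then have "eventually (\<lambda>k. (y \<circ> r1) k \<bullet> u > 0) sequentially"
      by (rule order_tendstoD) simp
    then obtain N2 where N2: "\<And>k. k \<ge> N2 \<Longrightarrow> (y \<circ> r1) k \<bullet> u > 0"
      unfolding eventually_sequentially by blast
    \<comment> \<open>The shift by \<open>N\<close> skips the zero terms, and the shift by
      \<open>N2\<close> makes the component along \<open>u\<close> positive for all indices rather
      than eventually.\<close>
    define s where "s k = r1 (k + N2) + N" for k
    have s: "strict_mono s" using r1 by (simp add: s_def strict_mono_def)
    define a where "a k = e (s k) \<bullet> u" for k
    define h where "h k = e (s k) - a k *\<^sub>R u" for k
    define z where "z k = (y \<circ> r1) (k + N2)" for k
    have nzs: "e (s k) \<noteq> 0" for k using nz[of "r1 (k + N2)"] by (simp add: s_def)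
    have z: "z k = e (s k) /\<^sub>R norm (e (s k))" for k by (simp add: z_def y_def s_def)
    have zlim: "z \<longlonglongrightarrow> u" unfolding z_def by (rule LIMSEQ_ignore_initial_segment[OF lim])
    have zu: "(\<lambda>k. z k \<bullet> u) \<longlonglongrightarrow> 1" unfolding z_def by (rule LIMSEQ_ignore_initial_segment[OF lim1])
    have zu_pos: "z k \<bullet> u > 0" for k using N2[of "k + N2"] by (simp add: z_def)
    have a: "a k = norm (e (s k)) * (z k \<bullet> u)" for k using nzs[of k] by (simp add: a_def z)
    have a_pos: "a k > 0" for k using zu_pos[of k] nzs[of k] by (simp add: a)
    have h: "h k = norm (e (s k)) *\<^sub>R (z k - (z k \<bullet> u) *\<^sub>R u)" for k
      using nzs[of k] by (simp add: h_def a_def z algebra_simps)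
    have "(\<lambda>k. norm (z k - (z k \<bullet> u) *\<^sub>R u) / (z k \<bullet> u)) \<longlonglongrightarrow> norm (u - 1 *\<^sub>R u) / 1"
      by (intro tendsto_intros zlim zu) simp
    moreover have "norm (h k) / a k = norm (z k - (z k \<bullet> u) *\<^sub>R u) / (z k \<bullet> u)" for k
      using nzs[of k] by (simp add: h a)
    ultimately have ratio: "(\<lambda>k. norm (h k) / a k) \<longlonglongrightarrow> 0" by simp
    define S' where "S' = S \<inter> {x. u \<bullet> x = 0}"
    have S': "subspace S'" unfolding S'_def
      by (intro subspace_inter less.prems subspace_hyperplane)
    have "u \<notin> S'" using uu by (simp add: S'_def)
    moreover have "S' \<subseteq> S" by (simp add: S'_def)
    ultimately have "S' \<subset> S" using \<open>u \<in> S\<close> by blast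
    then have dim: "dim S' < dim S"
      using dim_psubset[of S' S] span_eq_iff[of S'] span_eq_iff[of S] S' less.prems(1) by metis
    have hS': "h k \<in> S'" for k
      using less.prems \<open>u \<in> S\<close> uu
      by (auto simp: S'_def h_def a_def inner_diff_right inner_commute subspace_diff subspace_scale)
    obtain r2 us c where r2: "strict_mono (r2 :: nat \<Rightarrow> nat)" and fe: "flag_expansion S' (h \<circ> r2) us c"
      using less.hyps[of S' h, OF dim S' hS'] by blast
    note IH = flag_expansionD[OF fe]
    define c' where "c' k i = (case i of 0 \<Rightarrow> a (r2 k) | Suc j \<Rightarrow> c k j)" for k i
    have orth: "orthogonal u (us ! i)" if "i < length us" for i
      using IH(2) nth_mem[OF that] by (auto simp: S'_def orthogonal_def)
    \<comment> \<open>The first coefficient of the remainder is at most its norm, which is already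
      known to be negligible compared with \<open>a\<close>.\<close>
    have ratio0: "(\<lambda>k. c k 0 / a (r2 k)) \<longlonglongrightarrow> 0" if "us \<noteq> []"
    proof (rule tendsto_sandwich[OF _ _ tendsto_const])
      show "(\<lambda>k. norm (h (r2 k)) / a (r2 k)) \<longlonglongrightarrow> 0"
        using LIMSEQ_subseq_LIMSEQ[OF ratio r2] by (simp add: o_def)
      show "eventually (\<lambda>k. c k 0 / a (r2 k) \<le> norm (h (r2 k)) / a (r2 k)) sequentially"
        using flag_expansion_hd_le_norm[OF fe that] a_pos by (intro always_eventually allI divide_right_mono) (auto intro: less_imp_le)
      show "eventually (\<lambda>k. 0 \<le> c k 0 / a (r2 k)) sequentially"
        using that IH(6)[of 0] a_pos by (intro always_eventually allI divide_nonneg_pos) (auto intro: less_imp_le)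
    qed
    show ?thesis
    unfolding flag_expansion_def
    proof (intro exI conjI)
      show "strict_mono (s \<circ> r2)" using s r2 by (simp add: strict_mono_def)
      show "length (u # us) \<le> dim S" using IH(1) dim by simp
      show "set (u # us) \<subseteq> S" using IH(2) \<open>u \<in> S\<close> by (auto simp: S'_def)
      show "\<forall>i<length (u # us). norm ((u # us) ! i) = 1"
        using IH(3) u by (auto simp: less_Suc_eq_0_disj)
      show "\<forall>i<length (u # us). \<forall>j<length (u # us). i \<noteq> j \<longrightarrow> orthogonal ((u # us) ! i) ((u # us) ! j)"
      proof (intro allI impI)
        fix i j assume "i < length (u # us)" "j < length (u # us)" "i \<noteq> j"
        then show "orthogonal ((u # us) ! i) ((u # us) ! j)"
          using IH(4)[of "i - 1" "j - 1"] orth[of "i - 1"] orth[of "j - 1"]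
          by (cases i; cases j) (simp_all add: orthogonal_commute)
      qed
      show "\<forall>k. (e \<circ> (s \<circ> r2)) k = (\<Sum>i<length (u # us). c' k i *\<^sub>R (u # us) ! i)"
      proof
        fix k
        have "e (s (r2 k)) = a (r2 k) *\<^sub>R u + (h \<circ> r2) k" by (simp add: h_def)
        then show "(e \<circ> (s \<circ> r2)) k = (\<Sum>i<length (u # us). c' k i *\<^sub>R (u # us) ! i)"
          unfolding IH(5) by (simp add: c'_def sum.lessThan_Suc_shift del: sum.lessThan_Suc)
      qed
      show "\<forall>k. \<forall>i<length (u # us). c' k i > 0"
        using IH(6) a_pos by (auto simp: c'_def less_Suc_eq_0_disj)
      show "\<forall>i. Suc i < length (u # us) \<longrightarrow> (\<lambda>k. c' k (Suc i) / c' k i) \<longlonglongrightarrow> 0"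
      proof (intro allI impI)
        fix i assume "Suc i < length (u # us)"
        then show "(\<lambda>k. c' k (Suc i) / c' k i) \<longlonglongrightarrow> 0"
          using ratio0 IH(7) by (cases i) (auto simp: c'_def)
      qed
    qed
  qed
qed

section \<open>Simplices in flag coordinates\<close>

text \<open>
  In the coordinates \<open>c\<close> with respect to \<open>U\<close>, where \<open>c 0 = 1\<close>, the simplex of \<open>U\<close> with
  parameter \<open>m\<close> consists of the points whose coordinates decrease by a factor \<open>m\<close> at each step.
\<close>

definition flag_coords :: "nat \<Rightarrow> nat \<Rightarrow> (nat \<Rightarrow> real) set" where
  "flag_coords t m = {c. c 0 = 1 \<and> (\<forall>i<t. 0 \<le> c (Suc i) \<and> c (Suc i) * real m \<le> c i)}"

definition flag_point :: "(real ^ 'n) list \<Rightarrow> (nat \<Rightarrow> real) \<Rightarrow> real ^ 'n::finite" where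
  "flag_point U c = (\<Sum>i<length U. c i *\<^sub>R U ! i)"

lemma flag_coords_nonneg: "c \<in> flag_coords t m \<Longrightarrow> i \<le> t \<Longrightarrow> 0 \<le> c i"
  by (cases i) (auto simp: flag_coords_def)

lemma flag_coords_mono:
  assumes "m \<le> m'" shows "flag_coords t m' \<subseteq> flag_coords t m"
proof
  fix c assume c: "c \<in> flag_coords t m'"
  have "c (Suc i) * real m \<le> c i" if "i < t" for i
  proof -
    have "c (Suc i) * real m \<le> c (Suc i) * real m'"
      using c that assms by (intro mult_left_mono) (auto simp: flag_coords_def)
    then show ?thesis using c that by (force simp: flag_coords_def)
  qed
  then show "c \<in> flag_coords t m" using c by (auto simp: flag_coords_def)
qed

lemma flag_coords_decrease:
  assumes "c \<in> flag_coords t m" "m > 0" "j < i" "i \<le> t" shows "c i * real m \<le> c j"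
  using assms(3,4)
proof (induction i rule: less_induct)
  case (less i)
  then obtain i' where i': "i = Suc i'" by (cases i) auto
  have st: "c i * real m \<le> c i'" using assms(1) less.prems by (simp add: flag_coords_def i')
  show ?case
  proof (cases "i' = j")
    case False
    then have "c i' * real m \<le> c j" using less i' by simp
    moreover have "c i' * 1 \<le> c i' * real m"
      using flag_coords_nonneg[OF assms(1), of i'] less.prems assms(2) i' by (intro mult_left_mono) auto
    ultimately show ?thesis using st by simp
  qed (use st in simp)
qed

lemma abel_summation_vec:
  fixes w :: "nat \<Rightarrow> 'a::real_vector"
  shows "(\<Sum>k<t. (\<mu> k - \<mu> (Suc k)) *\<^sub>R (\<Sum>i\<le>k. w i)) + \<mu> t *\<^sub>R (\<Sum>i\<le>t. w i) = (\<Sum>i\<le>t. \<mu> i *\<^sub>R w i)"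
  by (induction t) (simp_all add: algebra_simps)

text \<open>The vertex \<open>p k\<close> has coordinates \<open>1 / m ^ i\<close> for
  \<open>i \<le> k\<close> and zero afterwards, and the coordinate set is convex. Conversely, the
  rescaled coordinates \<open>\<mu> i = c i * m ^ i\<close> decrease from 1, and summation by parts
  turns their successive differences, together with the last one, into barycentric
  coordinates.\<close>

lemma diff_simplex_eq:
  fixes U :: "(real ^ 'n::finite) list"
  assumes "length U = Suc t" "m > 0"
  shows "diff_simplex U m = flag_point U ` flag_coords t m"
proof -
  define w where "w i = (1 / real m ^ i) *\<^sub>R U ! i" for i
  define p where "p k = (\<Sum>i\<le>k. w i)" for k
  have p: "U ! 0 + (\<Sum>i=1..k. (1 / real m ^ i) *\<^sub>R U ! i) = p k" for k
    unfolding p_def atMost_atLeast0 by (subst sum.atLeast_Suc_atMost) (auto simp: w_def)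
  have simplex: "diff_simplex U m = convex hull (p ` {..t})"
    unfolding diff_simplex_def p assms(1) by (simp add: lessThan_Suc_atMost)
  show ?thesis
  proof
    have "p k \<in> flag_point U ` flag_coords t m" if "k \<le> t" for k
    proof
      let ?c = "\<lambda>i. if i \<le> k then 1 / real m ^ i else 0"
      show "?c \<in> flag_coords t m" using assms(2) by (auto simp: flag_coords_def)
      have "flag_point U ?c = (\<Sum>i\<le>t. if i \<le> k then w i else 0)"
        unfolding flag_point_def assms(1) lessThan_Suc_atMost
        by (intro sum.cong) (auto simp: w_def)
      also have "\<dots> = (\<Sum>i\<le>k. w i)" using that
        by (intro sum.mono_neutral_cong_right) auto
      finally show "p k = flag_point U ?c" by (simp add: p_def)
    qed
    moreover have "convex (flag_point U ` flag_coords t m)"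
    proof (rule convexI)
      fix x y and u v :: real
      assume "x \<in> flag_point U ` flag_coords t m" "y \<in> flag_point U ` flag_coords t m"
        and uv: "0 \<le> u" "0 \<le> v" "u + v = 1"
      then obtain c d where cd: "c \<in> flag_coords t m" "d \<in> flag_coords t m"
        and xy: "x = flag_point U c" "y = flag_point U d" by auto
      have "u *\<^sub>R x + v *\<^sub>R y = flag_point U (\<lambda>i. u * c i + v * d i)"
        by (simp add: xy flag_point_def scaleR_sum_right scaleR_left_distrib sum.distrib)
      moreover have "(\<lambda>i. u * c i + v * d i) \<in> flag_coords t m"
      proof -
        have "(u * c (Suc i) + v * d (Suc i)) * real m \<le> u * c i + v * d i" if "i < t" for i
        proof -
          have "u * (c (Suc i) * real m) + v * (d (Suc i) * real m) \<le> u * c i + v * d i"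
            using cd uv that by (intro add_mono mult_left_mono) (auto simp: flag_coords_def)
          then show ?thesis by (simp add: algebra_simps)
        qed
        then show ?thesis using cd uv by (auto simp: flag_coords_def)
      qed
      ultimately show "u *\<^sub>R x + v *\<^sub>R y \<in> flag_point U ` flag_coords t m" by blast
    qed
    ultimately show "diff_simplex U m \<subseteq> flag_point U ` flag_coords t m"
      unfolding simplex by (intro hull_minimal) auto
  next
    show "flag_point U ` flag_coords t m \<subseteq> diff_simplex U m"
    proof
      fix x assume "x \<in> flag_point U ` flag_coords t m"
      then obtain c where c: "c \<in> flag_coords t m" and x: "x = flag_point U c" by blast
      define \<mu> where "\<mu> i = c i * real m ^ i" for i
      define l where "l k = (if k < t then \<mu> k - \<mu> (Suc k) else \<mu> k)" for k
      have "x = (\<Sum>i\<le>t. \<mu> i *\<^sub>R w i)"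
        unfolding x flag_point_def assms(1) lessThan_Suc_atMost
        using assms(2) by (intro sum.cong) (auto simp: \<mu>_def w_def)
      also have "\<dots> = (\<Sum>k<t. (\<mu> k - \<mu> (Suc k)) *\<^sub>R p k) + \<mu> t *\<^sub>R p t"
        unfolding p_def by (rule abel_summation_vec[symmetric])
      also have "\<dots> = (\<Sum>k\<le>t. l k *\<^sub>R p k)"
        by (simp add: l_def flip: lessThan_Suc_atMost)
      finally have xl: "x = (\<Sum>k\<le>t. l k *\<^sub>R p k)" .
      have "(\<Sum>k\<le>t. l k) = (\<Sum>k<t. \<mu> k - \<mu> (Suc k)) + \<mu> t"
        by (simp add: l_def flip: lessThan_Suc_atMost)
      also have "\<dots> = \<mu> 0" by (induction t) auto
      also have "\<dots> = 1" using c by (simp add: \<mu>_def flag_coords_def)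
      finally have sum1: "(\<Sum>k\<le>t. l k) = 1" .
      have "\<mu> (Suc k) \<le> \<mu> k" if "k < t" for k
      proof -
        have "(c (Suc k) * real m) * real m ^ k \<le> c k * real m ^ k"
          using c that by (intro mult_right_mono) (auto simp: flag_coords_def)
        then show ?thesis by (simp add: \<mu>_def algebra_simps)
      qed
      then have "l k \<ge> 0" if "k \<le> t" for k
        using flag_coords_nonneg[OF c that] by (auto simp: l_def \<mu>_def)
      then show "x \<in> diff_simplex U m"
        unfolding simplex xl by (intro convex_sum convex_convex_hull sum1) (auto intro: hull_inc)
    qed
  qed
qed

lemma diff_simplex_mono:
  fixes U :: "(real ^ 'n::finite) list"
  assumes "U \<noteq> []" "0 < m" "m \<le> m'" shows "diff_simplex U m' \<subseteq> diff_simplex U m"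
proof -
  obtain t where t: "length U = Suc t" using assms(1) by (cases U) auto
  show ?thesis using diff_simplex_eq[OF t] flag_coords_mono[OF assms(3)] assms(2,3) by (simp add: image_mono)
qed

section \<open>Linear forms and truth functions on small simplices\<close>

lemma lead_coeff_dominates:
  assumes "j \<le> t" "\<And>i. i < j \<Longrightarrow> \<alpha> i = 0" "\<alpha> j > 0"
  shows "\<forall>\<^sub>F m in sequentially. \<forall>c\<in>flag_coords t m.
    (\<Sum>i\<le>t. \<alpha> i * c i) \<ge> 0 \<and> (c j > 0 \<longrightarrow> (\<Sum>i\<le>t. \<alpha> i * c i) > (0::real))"
proof -
  \<comment> \<open>Each coordinate after \<open>j\<close> is at most \<open>c j / m\<close>, so the
    terms other than the leading one contribute at most \<open>B * c j / m\<close> in absolute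
    value. For \<open>m > B / \<alpha> j\<close> this is outweighed by
    \<open>\<alpha> j * c j\<close>, uniformly in \<open>c\<close>.\<close>
  define B where "B = (\<Sum>i\<le>t. \<bar>\<alpha> i\<bar>)"
  have "\<forall>\<^sub>F m in sequentially. real m > B / \<alpha> j \<and> m > 0"
    by (intro eventually_conj eventually_gt_at_top)
      (metis filterlim_at_top_dense filterlim_real_sequentially)
  then show ?thesis
  proof eventually_elim
    case (elim m)
    show ?case
    proof
      fix c assume c: "c \<in> flag_coords t m"
      have cj: "c j \<ge> 0" using flag_coords_nonneg[OF c assms(1)] .
      have "(\<Sum>i\<in>{..t} - {j}. \<alpha> i * c i) \<ge> - (\<Sum>i\<in>{..t} - {j}. \<bar>\<alpha> i\<bar> * (c j / real m))"
        unfolding sum_negf[symmetric]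
      proof (rule sum_mono)
        fix i assume i: "i \<in> {..t} - {j}"
        show "- (\<bar>\<alpha> i\<bar> * (c j / real m)) \<le> \<alpha> i * c i"
        proof (cases "i < j")
          case False
          then have "c i * real m \<le> c j" using flag_coords_decrease[OF c] elim i by auto
          then have "\<bar>\<alpha> i\<bar> * c i \<le> \<bar>\<alpha> i\<bar> * (c j / real m)"
            using elim by (intro mult_left_mono) (auto simp: field_simps)
          moreover have "- (\<bar>\<alpha> i\<bar> * c i) \<le> \<alpha> i * c i"
            using flag_coords_nonneg[OF c, of i] i by (simp add: abs_if mult_nonneg_nonneg)
          ultimately show ?thesis by linarith
        qed (use assms(2) in simp)
      qed
      moreover have "(\<Sum>i\<in>{..t} - {j}. \<bar>\<alpha> i\<bar> * (c j / real m)) \<le> B * (c j / real m)"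
        unfolding B_def sum_distrib_right[symmetric]
        using cj by (intro mult_right_mono sum_mono2) auto
      moreover have "(\<Sum>i\<le>t. \<alpha> i * c i) = \<alpha> j * c j + (\<Sum>i\<in>{..t} - {j}. \<alpha> i * c i)"
        using assms(1) by (simp add: sum.remove)
      ultimately have ge: "(\<Sum>i\<le>t. \<alpha> i * c i) \<ge> c j * (\<alpha> j - B / real m)"
        by (simp add: algebra_simps)
      have pos: "\<alpha> j - B / real m > 0" using elim assms(3) by (simp add: field_simps)
      have "c j * (\<alpha> j - B / real m) \<ge> 0" "c j > 0 \<Longrightarrow> c j * (\<alpha> j - B / real m) > 0"
        using cj pos by simp_all
      then show "(\<Sum>i\<le>t. \<alpha> i * c i) \<ge> 0 \<and> (c j > 0 \<longrightarrow> (\<Sum>i\<le>t. \<alpha> i * c i) > 0)"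
        using ge by linarith
    qed
  qed
qed

lemma flag_sign_cases:
  fixes \<alpha> :: "nat \<Rightarrow> real"
  obtains (zero) "\<And>i. i \<le> t \<Longrightarrow> \<alpha> i = 0"
  | (pos) "\<forall>\<^sub>F m in sequentially. \<forall>c\<in>flag_coords t m.
      (\<Sum>i\<le>t. \<alpha> i * c i) \<ge> 0 \<and> ((\<forall>i\<le>t. c i > 0) \<longrightarrow> (\<Sum>i\<le>t. \<alpha> i * c i) > 0)"
  | (neg) "\<forall>\<^sub>F m in sequentially. \<forall>c\<in>flag_coords t m.
      (\<Sum>i\<le>t. \<alpha> i * c i) \<le> 0 \<and> ((\<forall>i\<le>t. c i > 0) \<longrightarrow> (\<Sum>i\<le>t. \<alpha> i * c i) < 0)"
proof (cases "\<exists>j. j \<le> t \<and> \<alpha> j \<noteq> 0")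
  case True
  then obtain j where j: "j \<le> t" "\<alpha> j \<noteq> 0" "\<And>i. i < j \<Longrightarrow> \<not> (i \<le> t \<and> \<alpha> i \<noteq> 0)"
    using exists_least_iff[of "\<lambda>j. j \<le> t \<and> \<alpha> j \<noteq> 0"] by auto
  then have z: "\<And>i. i < j \<Longrightarrow> \<alpha> i = 0" by auto
  show ?thesis
  proof (cases "\<alpha> j > 0")
    case True
    show ?thesis
      using lead_coeff_dominates[of j t \<alpha>, OF j(1) z True] j(1)
      by (intro pos) (auto elim: eventually_mono)
  next
    case False
    then have "- \<alpha> j > 0" using j(2) by simp
    from lead_coeff_dominates[of j t "\<lambda>i. - \<alpha> i", OF j(1) _ this] z j(1)
    show ?thesis by (intro neg) (auto elim: eventually_mono simp: sum_negf)
  qed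
qed (use zero in blast)

text \<open>Only the truncation in an implication can destroy linearity, and
  \<open>flag_sign_cases\<close> for the difference of the two forms decides which branch of the
  minimum is taken, for all large \<open>m\<close> at once. Since coordinate 0 is always 1, the
  constant 1 is the linear form with coefficients \<open>of_bool (i = 0)\<close>.\<close>

lemma eval_flag_linear:
  fixes U :: "(real ^ 'n::finite) list"
  assumes "length U = Suc t"
  shows "\<exists>\<alpha>. \<forall>\<^sub>F m in sequentially. \<forall>c\<in>flag_coords t m. eval \<phi> (flag_point U c) = (\<Sum>i\<le>t. \<alpha> i * c i)"
proof (induction \<phi>)
  case (Var j)
  have "eval (Var j) (flag_point U c) = (\<Sum>i\<le>t. U ! i $ j * c i)" for c
    by (simp add: flag_point_def assms lessThan_Suc_atMost mult.commute)
  then show ?case by (intro exI[of _ "\<lambda>i. U ! i $ j"]) simp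
next
  case (Neg \<phi>)
  then obtain \<alpha> where \<alpha>: "\<forall>\<^sub>F m in sequentially. \<forall>c\<in>flag_coords t m. eval \<phi> (flag_point U c) = (\<Sum>i\<le>t. \<alpha> i * c i)"
    by blast
  have "(\<Sum>i\<le>t. (of_bool (i = 0) - \<alpha> i) * c i) = 1 - (\<Sum>i\<le>t. \<alpha> i * c i)" if "c 0 = 1" for c
    using that by (simp add: left_diff_distrib sum_subtractf)
  then show ?case using \<alpha>
    by (intro exI[of _ "\<lambda>i. of_bool (i = 0) - \<alpha> i"]) (auto elim!: eventually_mono simp: flag_coords_def)
next
  case (Imp \<phi> \<psi>)
  then obtain \<alpha> \<beta> where "\<forall>\<^sub>F m in sequentially. \<forall>c\<in>flag_coords t m. eval \<phi> (flag_point U c) = (\<Sum>i\<le>t. \<alpha> i * c i)"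
    "\<forall>\<^sub>F m in sequentially. \<forall>c\<in>flag_coords t m. eval \<psi> (flag_point U c) = (\<Sum>i\<le>t. \<beta> i * c i)"
    by blast
  then have ev: "\<forall>\<^sub>F m in sequentially. \<forall>c\<in>flag_coords t m.
      eval (Imp \<phi> \<psi>) (flag_point U c) = min 1 (1 + (\<Sum>i\<le>t. (\<beta> i - \<alpha> i) * c i))"
    by eventually_elim (simp add: left_diff_distrib sum_subtractf algebra_simps)
  have one: "(\<Sum>i\<le>t. of_bool (i = 0) * c i) = 1" if "c 0 = 1" for c :: "nat \<Rightarrow> real"
    using that by simp
  have plus: "(\<Sum>i\<le>t. (of_bool (i = 0) + (\<beta> i - \<alpha> i)) * c i) = 1 + (\<Sum>i\<le>t. (\<beta> i - \<alpha> i) * c i)"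
    if "c 0 = 1" for c :: "nat \<Rightarrow> real"
    using one[of c, OF that] by (simp add: distrib_right sum.distrib)
  show ?case
  proof (cases rule: flag_sign_cases[of t "\<lambda>i. \<beta> i - \<alpha> i"])
    case zero
    then have "(\<Sum>i\<le>t. (\<beta> i - \<alpha> i) * c i) = 0" for c by (intro sum.neutral) auto
    then show ?thesis using ev one
      by (intro exI[of _ "\<lambda>i. of_bool (i = 0)"]) (auto elim!: eventually_mono simp: flag_coords_def)
  next
    case pos
    with ev have "\<forall>\<^sub>F m in sequentially. \<forall>c\<in>flag_coords t m.
        eval (Imp \<phi> \<psi>) (flag_point U c) = (\<Sum>i\<le>t. of_bool (i = 0) * c i)"
    proof eventually_elim
      case (elim m)
      then show ?case using one by (simp add: flag_coords_def)
    qed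
    then show ?thesis by (rule exI[of _ "\<lambda>i. of_bool (i = 0)"])
  next
    case neg
    with ev have "\<forall>\<^sub>F m in sequentially. \<forall>c\<in>flag_coords t m.
        eval (Imp \<phi> \<psi>) (flag_point U c) = (\<Sum>i\<le>t. (of_bool (i = 0) + (\<beta> i - \<alpha> i)) * c i)"
    proof eventually_elim
      case (elim m)
      then show ?case using plus by (simp add: flag_coords_def)
    qed
    then show ?thesis by (rule exI[of _ "\<lambda>i. of_bool (i = 0) + (\<beta> i - \<alpha> i)"])
  qed
qed

section \<open>Completeness for differential valuations\<close>

lemma derives_imp_diff_models:
  fixes \<Theta> :: "'n::finite form set"
  assumes "derives \<Theta> \<phi>" "diff_valuation U" "diff_sat_set U \<Theta>"
  shows "diff_sat U \<phi>"
proof -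
  have ne: "U \<noteq> []" using assms(2) by (simp add: diff_valuation_def)
  have "\<forall>\<^sub>F m in sequentially. diff_simplex U m \<subseteq> cbox 0 1 \<and> m > 0"
    using assms(2) by (intro eventually_conj eventually_gt_at_top) (simp add: diff_valuation_def)
  then obtain m0 where m0: "diff_simplex U m0 \<subseteq> cbox 0 1" "m0 > 0"
    unfolding eventually_sequentially by blast
  have valid: "diff_sat U \<gamma>" if "\<And>v. v \<in> cbox 0 1 \<Longrightarrow> eval \<gamma> v = 1" for \<gamma>
    unfolding diff_sat_def using m0 that by blast
  from assms(1) show ?thesis
  proof (induction rule: derives.induct)
    case (hyp \<phi>)
    then show ?case using assms(3) by (simp add: diff_sat_set_def)
  next
    case (ax1 \<phi> \<psi>)
    show ?case using eval_in_unit[of _ \<phi>] eval_in_unit[of _ \<psi>] by (intro valid) (fastforce simp: min_def)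
  next
    case (ax2 \<phi> \<psi> \<gamma>)
    show ?case by (intro valid) (auto simp: min_def)
  next
    case (ax3 \<phi> \<psi>)
    show ?case by (intro valid) (auto simp: min_def)
  next
    case (ax4 \<phi> \<psi>)
    show ?case by (intro valid) (auto simp: min_def)
  next
    case (mp \<phi> \<psi>)
    from mp.IH(1) obtain m where m: "m > 0" "diff_simplex U m \<subseteq> cbox 0 1"
      "\<And>v. v \<in> diff_simplex U m \<Longrightarrow> eval \<phi> v = 1" by (auto simp: diff_sat_def)
    from mp.IH(2) obtain m' where m': "m' > 0"
      "\<And>v. v \<in> diff_simplex U m' \<Longrightarrow> eval (Imp \<phi> \<psi>) v = 1" unfolding diff_sat_def by auto
    \<comment> \<open>The premises may hold on simplices with different parameters; as simplices
      shrink with growing parameter, the larger parameter serves both.\<close>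
    have sub: "diff_simplex U (max m m') \<subseteq> diff_simplex U m \<inter> diff_simplex U m'"
      using diff_simplex_mono[OF ne m(1), of "max m m'"] diff_simplex_mono[OF ne m'(1), of "max m m'"] by simp
    have "eval \<psi> v = 1" if "v \<in> diff_simplex U (max m m')" for v
    proof -
      have "v \<in> diff_simplex U m" "v \<in> diff_simplex U m'" using sub that by auto
      then show ?thesis using m(3)[of v] m'(2)[of v] eval_in_unit[of v \<psi>] m(2) by auto
    qed
    then show ?case unfolding diff_sat_def using m(1,2) sub by (intro exI[of _ "max m m'"]) (simp add: less_max_iff_disj, blast)
  qed
qed

text \<open>Along a subsequence the points converge to \<open>u0\<close>, and a flag expansion of
  the displacements supplies the directions of \<open>U\<close>. In these coordinates
  \<open>v (r k)\<close> is \<open>d k\<close>, which has only positive entries and eventually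
  enters every \<open>flag_coords t m\<close>. Hence the sign of a linear form at these points
  settles its sign on all sufficiently small simplices.\<close>

lemma diff_valuation_limit:
  fixes v :: "nat \<Rightarrow> real ^ 'n::finite"
  assumes "\<And>k. v k \<in> cbox 0 1"
  obtains U where "diff_valuation U"
    "\<And>\<phi>. (\<forall>\<^sub>F k in sequentially. eval \<phi> (v k) = 1) \<Longrightarrow> diff_sat U \<phi>"
    "\<And>\<phi>. (\<And>k. eval \<phi> (v k) \<noteq> 1) \<Longrightarrow> \<not> diff_sat U \<phi>"
proof -
  have "compact (cbox 0 1 :: (real ^ 'n) set)" by (rule compact_cbox)
  then obtain u0 r0 where r0: "strict_mono r0" and lim: "(v \<circ> r0) \<longlonglongrightarrow> u0"
    unfolding compact_def using assms by blast
  define e where "e k = v (r0 k) - u0" for k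
  have elim0: "(\<lambda>k. norm (e k)) \<longlonglongrightarrow> 0"
    using lim unfolding e_def by (simp add: LIM_zero o_def tendsto_norm_zero)
  obtain r1 us c where r1: "strict_mono (r1 :: nat \<Rightarrow> nat)" and fe: "flag_expansion UNIV (e \<circ> r1) us c"
    using flag_expansion_exists[OF subspace_UNIV, of e] by auto
  note us = flag_expansionD[OF fe]
  define t where "t = length us"
  define U where "U = u0 # us"
  define d where "d k i = (case i of 0 \<Rightarrow> 1 | Suc j \<Rightarrow> c k j)" for k i
  define r where "r = r0 \<circ> r1"
  have r: "strict_mono r" using r0 r1 by (simp add: r_def strict_mono_def)
  have len: "length U = Suc t" by (simp add: U_def t_def)
  have point: "flag_point U (d k) = v (r k)" for k
  proof -
    have "flag_point U (d k) = u0 + (e \<circ> r1) k"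
      unfolding flag_point_def us(5)
      by (simp add: U_def d_def sum.lessThan_Suc_shift del: sum.lessThan_Suc)
    then show ?thesis by (simp add: e_def r_def)
  qed
  have d_pos: "d k i > 0" if "i \<le> t" for k i
    using that us(6) by (cases i) (auto simp: d_def t_def)
  have ratio: "(\<lambda>k. d k (Suc i) / d k i) \<longlonglongrightarrow> 0" if "i < t" for i
  proof (cases i)
    case 0
    then have ne: "us \<noteq> []" using that by (auto simp: t_def)
    \<comment> \<open>As \<open>d k 0 = 1\<close>, the first ratio is \<open>c k 0\<close> itself,
      which the norm of the displacement bounds.\<close>
    have "(\<lambda>k. c k 0) \<longlonglongrightarrow> 0"
    proof (rule tendsto_sandwich[OF _ _ tendsto_const])
      show "(\<lambda>k. norm (e (r1 k))) \<longlonglongrightarrow> 0"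
        using LIMSEQ_subseq_LIMSEQ[OF elim0 r1] by (simp add: o_def)
      show "\<forall>\<^sub>F k in sequentially. c k 0 \<le> norm (e (r1 k))"
        using flag_expansion_hd_le_norm[OF fe ne] by simp
      show "\<forall>\<^sub>F k in sequentially. 0 \<le> c k 0"
        using us(6)[of 0] ne by (auto intro!: always_eventually less_imp_le)
    qed
    then show ?thesis by (simp add: 0 d_def)
  next
    case (Suc j)
    then show ?thesis using us(7)[of j] that by (simp add: d_def t_def)
  qed
  have cone: "\<forall>\<^sub>F k in sequentially. d k \<in> flag_coords t m" for m
  proof -
    have "\<forall>\<^sub>F k in sequentially. d k (Suc i) * real m \<le> d k i" if i: "i < t" for i
    proof -
      have "(\<lambda>k. d k (Suc i) / d k i * real m) \<longlonglongrightarrow> 0 * real m"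
        by (intro tendsto_intros ratio i)
      then have "\<forall>\<^sub>F k in sequentially. d k (Suc i) / d k i * real m < 1"
        by (intro order_tendstoD(2)) auto
      then show ?thesis
      proof eventually_elim
        case (elim k)
        then show ?case using d_pos[of i k] i by (simp add: field_simps)
      qed
    qed
    then have "\<forall>\<^sub>F k in sequentially. \<forall>i\<in>{..<t}. d k (Suc i) * real m \<le> d k i"
      by (intro eventually_ball_finite) auto
    then show ?thesis
    proof eventually_elim
      case (elim k)
      then show ?case using d_pos by (auto simp: flag_coords_def d_def[of k 0] intro!: less_imp_le)
    qed
  qed
  have hits: "\<exists>k\<ge>K. d k \<in> flag_coords t m" for K m
    using cone[of m] unfolding eventually_sequentially by (meson nle_le)
  \<comment> \<open>A form of negative sign would be strictly negative at some \<open>d k\<close>,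
    whose coordinates are all positive.\<close>
  have nonneg: "\<forall>\<^sub>F m in sequentially. \<forall>c\<in>flag_coords t m. (\<Sum>i\<le>t. \<alpha> i * c i) \<ge> 0"
    if ev: "\<And>k. (\<Sum>i\<le>t. \<alpha> i * d k i) \<ge> 0" for \<alpha> :: "nat \<Rightarrow> real"
  proof (cases rule: flag_sign_cases[of t \<alpha>])
    case zero
    then show ?thesis by simp
  next
    case pos
    then show ?thesis by eventually_elim auto
  next
    case neg
    then obtain m where m: "\<And>c. c \<in> flag_coords t m \<Longrightarrow> (\<forall>i\<le>t. c i > 0) \<Longrightarrow> (\<Sum>i\<le>t. \<alpha> i * c i) < 0"
      unfolding eventually_sequentially by blast
    obtain k where "d k \<in> flag_coords t m" using hits by blast
    then show ?thesis using m[of "d k"] d_pos ev[of k] by force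
  qed
  have coord: "flag_point U c $ i = (\<Sum>j\<le>t. U ! j $ i * c j)" for c i
    by (simp add: flag_point_def len lessThan_Suc_atMost mult.commute)
  have vbox: "0 \<le> v k $ i" "v k $ i \<le> 1" for k i using assms[of k] by (auto simp: mem_box_cart)
  have "\<forall>\<^sub>F m in sequentially. \<forall>c\<in>flag_coords t m. 0 \<le> flag_point U c $ i" for i
    unfolding coord using vbox(1)[of _ i] by (intro nonneg) (simp flip: coord add: point)
  moreover have "\<forall>\<^sub>F m in sequentially. \<forall>c\<in>flag_coords t m. flag_point U c $ i \<le> 1" for i
  proof -
    have split: "(\<Sum>j\<le>t. (of_bool (j = 0) - U ! j $ i) * c j) = 1 - flag_point U c $ i" if "c 0 = 1" for c
      using that by (simp add: coord left_diff_distrib sum_subtractf)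
    have "\<forall>\<^sub>F m in sequentially. \<forall>c\<in>flag_coords t m. (\<Sum>j\<le>t. (of_bool (j = 0) - U ! j $ i) * c j) \<ge> 0"
    proof (rule nonneg)
      fix k
      show "0 \<le> (\<Sum>j\<le>t. (of_bool (j = 0) - U ! j $ i) * d k j)"
        using split[of "d k"] vbox(2)[of "r k" i] by (simp add: point d_def[of k 0])
    qed
    then show ?thesis by eventually_elim (simp add: flag_coords_def split)
  qed
  ultimately have "\<forall>\<^sub>F m in sequentially. \<forall>i\<in>UNIV. (\<forall>c\<in>flag_coords t m. 0 \<le> flag_point U c $ i)
      \<and> (\<forall>c\<in>flag_coords t m. flag_point U c $ i \<le> 1)"
    by (intro eventually_ball_finite ballI eventually_conj) auto
  moreover have "\<forall>\<^sub>F m::nat in sequentially. m > 0" by (rule eventually_gt_at_top)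
  ultimately have box: "\<forall>\<^sub>F m in sequentially. diff_simplex U m \<subseteq> cbox 0 1"
    by eventually_elim (auto simp: diff_simplex_eq[OF len] mem_box_cart)
  show ?thesis
  proof (rule that[of U])
    have "t \<le> CARD('n)" using us(1) by (simp add: t_def)
    moreover have "norm (U ! i) = 1" if "i \<in> {1..t}" for i
      using that us(3)[of "i - 1"] by (cases i) (auto simp: U_def t_def)
    moreover have "orthogonal (U ! i) (U ! j)" if "i \<in> {1..t}" "j \<in> {1..t}" "i \<noteq> j" for i j
      using that us(4)[of "i - 1" "j - 1"] by (cases i; cases j) (auto simp: U_def t_def)
    ultimately show "diff_valuation U"
      using box len by (auto simp: diff_valuation_def diff_order_def)
    show "\<not> diff_sat U \<phi>" if ne1: "\<And>k. eval \<phi> (v k) \<noteq> 1" for \<phi>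
    proof
      assume "diff_sat U \<phi>"
      then obtain m where m: "m > 0" "\<And>x. x \<in> diff_simplex U m \<Longrightarrow> eval \<phi> x = 1"
        unfolding diff_sat_def by blast
      obtain k where "d k \<in> flag_coords t m" using hits by blast
      then have "v (r k) \<in> diff_simplex U m"
        unfolding diff_simplex_eq[OF len m(1)] point[symmetric] by (rule imageI)
      then show False using m(2) ne1 by blast
    qed
    show "diff_sat U \<phi>" if ev1: "\<forall>\<^sub>F k in sequentially. eval \<phi> (v k) = 1" for \<phi>
    proof -
      \<comment> \<open>\<open>Neg \<phi>\<close> is used so that the value to be attained is 0. A
        linear form with a nonzero coefficient would not vanish at late points \<open>d k\<close>,
        against \<open>eval \<phi> (v k) = 1\<close> there.\<close>
      obtain \<alpha> where \<alpha>: "\<forall>\<^sub>F m in sequentially. \<forall>c\<in>flag_coords t m.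
          eval (Neg \<phi>) (flag_point U c) = (\<Sum>i\<le>t. \<alpha> i * c i)"
        using eval_flag_linear[OF len] by blast
      obtain K where K: "\<And>k. k \<ge> K \<Longrightarrow> eval \<phi> (v k) = 1"
        using ev1 unfolding eventually_sequentially by blast
      have strict: False
        if "\<forall>\<^sub>F m in sequentially. \<forall>c\<in>flag_coords t m. (\<forall>i\<le>t. c i > 0) \<longrightarrow> (\<Sum>i\<le>t. \<alpha> i * c i) \<noteq> 0"
      proof -
        have "\<forall>\<^sub>F m in sequentially. \<forall>c\<in>flag_coords t m. (\<forall>i\<le>t. c i > 0) \<longrightarrow> eval (Neg \<phi>) (flag_point U c) \<noteq> 0"
          using that \<alpha> by eventually_elim auto
        then obtain m where m: "\<And>c. c \<in> flag_coords t m \<Longrightarrow> \<forall>i\<le>t. c i > 0 \<Longrightarrow> eval (Neg \<phi>) (flag_point U c) \<noteq> 0"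
          unfolding eventually_sequentially by blast
        obtain k where k: "k \<ge> K" "d k \<in> flag_coords t m" using hits by blast
        have "K \<le> r k" using k(1) seq_suble[OF r, of k] by simp
        then show False using m[OF k(2)] d_pos K[of "r k"] by (simp add: point)
      qed
      have "\<forall>\<^sub>F m in sequentially. \<forall>c\<in>flag_coords t m. (\<Sum>i\<le>t. \<alpha> i * c i) = 0"
      proof (cases rule: flag_sign_cases[of t \<alpha>])
        case zero
        then show ?thesis by simp
      next
        case pos
        then have False by (intro strict) (auto elim!: eventually_mono)
        then show ?thesis ..
      next
        case neg
        then have False by (intro strict) (auto elim!: eventually_mono)
        then show ?thesis ..
      qed
      with \<alpha> box have "\<forall>\<^sub>F m in sequentially. diff_simplex U m \<subseteq> cbox 0 1 \<and>
          (\<forall>c\<in>flag_coords t m. eval \<phi> (flag_point U c) = 1) \<and> m > 0"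
        using eventually_gt_at_top[of "0::nat"] by eventually_elim auto
      then obtain m where "diff_simplex U m \<subseteq> cbox 0 1" "\<forall>c\<in>flag_coords t m. eval \<phi> (flag_point U c) = 1" "m > 0"
        unfolding eventually_sequentially by blast
      then show ?thesis unfolding diff_sat_def by (intro exI[of _ m]) (auto simp: diff_simplex_eq[OF len])
    qed
  qed
qed

instance form :: (countable) countable
  by countable_datatype

text \<open>As there are countably many formulas, \<open>\<Theta>\<close> is an increasing union of
  finite sets \<open>F k\<close>. Points refuting \<open>\<psi>\<close> and satisfying
  \<open>F k\<close> eventually satisfy each member of \<open>\<Theta>\<close>, and passing to a
  differential valuation keeps both properties.\<close>

theorem differential_completeness:
  fixes \<Theta> :: "'n::finite form set"
  assumes "\<not> derives \<Theta> \<psi>"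
  obtains U where "diff_valuation U" "diff_sat_set U \<Theta>" "\<not> diff_sat U \<psi>"
proof -
  define F where "F k = {\<theta>\<in>\<Theta>. to_nat \<theta> < k}" for k
  have fin: "finite (F k)" for k
  proof -
    have "finite (to_nat -` {..<k} :: 'n form set)" by (intro finite_vimageI) auto
    then show ?thesis by (rule rev_finite_subset) (auto simp: F_def)
  qed
  have nd: "\<not> derives (F k) \<psi>" for k using assms derives_mono[of "F k" \<psi> \<Theta>] by (auto simp: F_def)
  have "\<exists>v. v \<in> cbox 0 1 \<and> (\<forall>\<theta>\<in>F k. eval \<theta> v = 1) \<and> eval \<psi> v < 1" for k
  proof -
    obtain v where "v \<in> cbox 0 1" "\<And>\<theta>. \<theta> \<in> F k \<Longrightarrow> eval \<theta> v = 1" "eval \<psi> v < 1"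
      using finite_completeness[OF fin[of k] nd[of k]] by metis
    then show ?thesis by blast
  qed
  then obtain v where "\<And>k. v k \<in> cbox 0 1 \<and> (\<forall>\<theta>\<in>F k. eval \<theta> (v k) = 1) \<and> eval \<psi> (v k) < 1" by metis
  then have v: "\<And>k. v k \<in> cbox 0 1" "\<And>k \<theta>. \<theta> \<in> F k \<Longrightarrow> eval \<theta> (v k) = 1" "\<And>k. eval \<psi> (v k) < 1"
    by simp_all
  obtain U where U: "diff_valuation U"
    "\<And>\<phi>. (\<forall>\<^sub>F k in sequentially. eval \<phi> (v k) = 1) \<Longrightarrow> diff_sat U \<phi>"
    "\<And>\<phi>. (\<And>k. eval \<phi> (v k) \<noteq> 1) \<Longrightarrow> \<not> diff_sat U \<phi>"
    by (rule diff_valuation_limit[of v]) (use v(1) in auto)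
  show ?thesis
  proof (rule that[OF U(1)])
    show "\<not> diff_sat U \<psi>" using v(3) by (intro U(3)) (metis less_irrefl)
    have "\<forall>\<^sub>F k in sequentially. eval \<theta> (v k) = 1" if "\<theta> \<in> \<Theta>" for \<theta>
      using eventually_gt_at_top[of "to_nat \<theta>"] by eventually_elim (use that v(2) in \<open>auto simp: F_def\<close>)
    then show "diff_sat_set U \<Theta>" unfolding diff_sat_set_def using U(2) by blast
  qed
qed

section \<open>Maximal ideals and semisimplicity\<close>

lemma derives_imp_models:
  fixes \<Theta> :: "'n::finite form set"
  assumes "derives \<Theta> \<phi>" "v \<in> cbox 0 1" "\<forall>\<theta>\<in>\<Theta>. eval \<theta> v = 1"
  shows "eval \<phi> v = 1"
  using derives_imp_diff_models[OF assms(1), of "[v]"] assms(2,3)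
  by (simp add: diff_valuation_order_0 diff_sat_order_0 diff_sat_set_def)

lemma diff_sat_imp_eval_base:
  fixes U :: "(real ^ 'n::finite) list"
  assumes "U \<noteq> []" "diff_sat U \<phi>"
  shows "U ! 0 \<in> cbox 0 1" "eval \<phi> (U ! 0) = 1"
proof -
  have "U ! 0 \<in> diff_simplex U m" for m
    unfolding diff_simplex_def using assms(1) by (intro hull_inc image_eqI[of _ _ 0]) auto
  then show "U ! 0 \<in> cbox 0 1" "eval \<phi> (U ! 0) = 1"
    using assms(2) unfolding diff_sat_def by blast+
qed

text \<open>The kernel of evaluation at \<open>v\<close>; evaluation respects the classes when
  \<open>v\<close> satisfies \<open>\<Theta>\<close>.\<close>

definition point_ideal :: "'n::finite form set \<Rightarrow> real ^ 'n \<Rightarrow> 'n form set set" where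
  "point_ideal \<Theta> v = {lind_rel \<Theta> `` {\<phi>} | \<phi>. eval \<phi> v = 0}"

context
  fixes \<Theta> :: "'n::finite form set" and v :: "real ^ 'n"
  assumes v: "v \<in> cbox 0 1" "\<forall>\<theta>\<in>\<Theta>. eval \<theta> v = 1"
begin

lemma derives_Imp_eval_le: "derives \<Theta> (Imp a b) \<Longrightarrow> eval a v \<le> eval b v"
  using derives_imp_models[of \<Theta> "Imp a b" v] v by simp

lemma cls_in_point_ideal: "lind_rel \<Theta> `` {\<phi>} \<in> point_ideal \<Theta> v \<longleftrightarrow> eval \<phi> v = 0"
proof
  assume "lind_rel \<Theta> `` {\<phi>} \<in> point_ideal \<Theta> v"
  then obtain \<psi> where "lind_rel \<Theta> `` {\<phi>} = lind_rel \<Theta> `` {\<psi>}" "eval \<psi> v = 0"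
    unfolding point_ideal_def by auto
  then show "eval \<phi> v = 0"
    using derives_Imp_eval_le[of \<phi> \<psi>] derives_Imp_eval_le[of \<psi> \<phi>] by (simp add: cls_eq_iff lind_rel_iff)
qed (auto simp: point_ideal_def)

lemma mv_ideal_point_ideal: "mv_ideal (LIND \<Theta>) (point_ideal \<Theta> v)"
  unfolding mv_ideal_def
proof (intro conjI ballI impI)
  show sub: "point_ideal \<Theta> v \<subseteq> mv_carrier (LIND \<Theta>)" by (auto simp: point_ideal_def LIND_carrier)
  show "mv_zero (LIND \<Theta>) \<in> point_ideal \<Theta> v"
    unfolding LIND_zero[of _ undefined] cls_in_point_ideal by simp
  fix x assume x: "x \<in> point_ideal \<Theta> v"
  then obtain a where a: "x = lind_rel \<Theta> `` {a}" "eval a v = 0" unfolding point_ideal_def by auto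
  show "mv_oplus (LIND \<Theta>) x y \<in> point_ideal \<Theta> v" if "y \<in> point_ideal \<Theta> v" for y
  proof -
    obtain b where "y = lind_rel \<Theta> `` {b}" "eval b v = 0" using \<open>y \<in> _\<close> unfolding point_ideal_def by auto
    then show ?thesis using a by (simp add: LIND_oplus cls_in_point_ideal eval_Oplus)
  qed
  show "y \<in> point_ideal \<Theta> v" if y: "y \<in> mv_carrier (LIND \<Theta>)" and le: "mv_le (LIND \<Theta>) y x" for y
  proof -
    obtain b where b: "y = lind_rel \<Theta> `` {b}" using y by (auto simp: LIND_carrier)
    then have "eval b v \<le> 0" using le derives_Imp_eval_le[of b a] a by (simp add: LIND_le_iff)
    then show ?thesis using b eval_in_unit[OF v(1), of b] by (simp add: cls_in_point_ideal)
  qed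
qed

lemma point_ideal_proper: "point_ideal \<Theta> v \<noteq> mv_carrier (LIND \<Theta>)"
proof
  assume "point_ideal \<Theta> v = mv_carrier (LIND \<Theta>)"
  then have "lind_rel \<Theta> `` {Imp a a} \<in> point_ideal \<Theta> v" for a by (auto simp: LIND_carrier)
  then show False unfolding cls_in_point_ideal by simp
qed

text \<open>An ideal strictly above the point ideal contains the class of some \<open>\<phi>\<close>
  with positive value at \<open>v\<close>. By the Archimedean property a multiple of
  \<open>\<phi>\<close> has value 1 there, so the negation of this multiple lies in the point ideal,
  and the sum of the two is the unit.\<close>

lemma mv_maximal_ideal_point_ideal: "mv_maximal_ideal (LIND \<Theta>) (point_ideal \<Theta> v)"
proof -
  have "J = point_ideal \<Theta> v"
    if J: "mv_ideal (LIND \<Theta>) J" "point_ideal \<Theta> v \<subseteq> J" "J \<noteq> mv_carrier (LIND \<Theta>)" for J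
  proof (rule ccontr)
    assume "J \<noteq> point_ideal \<Theta> v"
    have closed: "\<And>x y. x \<in> J \<Longrightarrow> y \<in> J \<Longrightarrow> mv_oplus (LIND \<Theta>) x y \<in> J"
        "\<And>x y. x \<in> J \<Longrightarrow> y \<in> mv_carrier (LIND \<Theta>) \<Longrightarrow> mv_le (LIND \<Theta>) y x \<Longrightarrow> y \<in> J"
        "J \<subseteq> mv_carrier (LIND \<Theta>)"
      using J(1) unfolding mv_ideal_def by auto
    obtain x where x: "x \<in> J" "x \<notin> point_ideal \<Theta> v" using J(2) \<open>J \<noteq> point_ideal \<Theta> v\<close> by blast
    obtain \<phi> where \<phi>: "x = lind_rel \<Theta> `` {\<phi>}" using x(1) closed(3) by (auto simp: LIND_carrier)
    have pos: "eval \<phi> v > 0"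
      using x(2) eval_in_unit[OF v(1), of \<phi>] by (auto simp: \<phi> cls_in_point_ideal)
    \<comment> \<open>\<open>mult k\<close> is the sum of \<open>Suc k\<close> copies of
      \<open>\<phi>\<close>.\<close>
    define mult where "mult k = ((Oplus \<phi>) ^^ k) \<phi>" for k
    have multJ: "lind_rel \<Theta> `` {mult k} \<in> J" for k
    proof (induction k)
      case 0
      then show ?case using x by (simp add: mult_def \<phi>)
    next
      case (Suc k)
      from closed(1)[OF x(1) this] show ?case by (simp add: mult_def \<phi> LIND_oplus)
    qed
    have eval_mult: "eval (mult k) v = min 1 (real (Suc k) * eval \<phi> v)" for k
    proof (induction k)
      case 0
      then show ?case using eval_in_unit[OF v(1), of \<phi>] by (simp add: mult_def)
    next
      case (Suc k)
      then show ?case using pos by (simp add: mult_def eval_Oplus min_def algebra_simps)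
    qed
    obtain k where "real k * eval \<phi> v > 1" using pos ex_less_of_nat_mult by blast
    then have "real (Suc k) * eval \<phi> v \<ge> 1" using pos by (simp add: algebra_simps)
    then have "eval (Neg (mult k)) v = 0" using eval_mult[of k] by simp
    then have "lind_rel \<Theta> `` {Neg (mult k)} \<in> J" using J(2) cls_in_point_ideal by blast
    from closed(1)[OF this multJ[of k]] have one: "lind_rel \<Theta> `` {Oplus (Neg (mult k)) (mult k)} \<in> J"
      by (simp add: LIND_oplus)
    have "y \<in> J" if y: "y \<in> mv_carrier (LIND \<Theta>)" for y
    proof (rule closed(2)[OF one y])
      obtain b where b: "y = lind_rel \<Theta> `` {b}" using y by (auto simp: LIND_carrier)
      have "derives \<Theta> (Oplus (Neg (mult k)) (mult k))" unfolding Oplus_def by (rule d_dn1)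
      then show "mv_le (LIND \<Theta>) y (lind_rel \<Theta> `` {Oplus (Neg (mult k)) (mult k)})"
        unfolding b LIND_le_iff by (rule mp[OF _ ax1])
    qed
    then show False using J(3) closed(3) by blast
  qed
  then show ?thesis
    unfolding mv_maximal_ideal_def using mv_ideal_point_ideal point_ideal_proper by blast
qed

end

text \<open>The formulas with negation in \<open>M\<close> form a consistent, deductively closed
  theory \<open>\<Gamma>\<close>. Completeness gives a differential valuation satisfying
  \<open>\<Gamma>\<close>; its base point \<open>v\<close> then satisfies \<open>\<Gamma>\<close> as
  well, so \<open>M\<close> lies in the point ideal of \<open>v\<close>, and maximality makes them
  equal.\<close>

lemma maximal_ideal_eq_point_ideal:
  fixes \<Theta> :: "'n::finite form set"
  assumes M: "mv_maximal_ideal (LIND \<Theta>) M"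
  obtains v where "v \<in> cbox 0 1" "\<forall>\<theta>\<in>\<Theta>. eval \<theta> v = 1" "M = point_ideal \<Theta> v"
proof -
  define \<Gamma> where "\<Gamma> = {\<phi>. lind_rel \<Theta> `` {Neg \<phi>} \<in> M}"
  have ideal: "M \<subseteq> mv_carrier (LIND \<Theta>)" "mv_zero (LIND \<Theta>) \<in> M"
      "\<And>x y. x \<in> M \<Longrightarrow> y \<in> M \<Longrightarrow> mv_oplus (LIND \<Theta>) x y \<in> M"
      "\<And>x y. x \<in> M \<Longrightarrow> y \<in> mv_carrier (LIND \<Theta>) \<Longrightarrow> mv_le (LIND \<Theta>) y x \<Longrightarrow> y \<in> M"
    using M unfolding mv_maximal_ideal_def mv_ideal_def by auto
  have le: "lind_rel \<Theta> `` {a} \<in> M" if "lind_rel \<Theta> `` {b} \<in> M" "derives \<Theta> (Imp a b)" for a b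
    using ideal(4)[OF that(1), of "lind_rel \<Theta> `` {a}"] that(2) by (simp add: LIND_carrier LIND_le_iff)
  have base: "\<phi> \<in> \<Gamma>" if "derives \<Theta> \<phi>" for \<phi>
  proof -
    have "derives \<Theta> (Imp (Neg \<phi>) (Neg (Imp \<phi> \<phi>)))" by (rule d_contraI[OF mp[OF that ax1]])
    then show ?thesis using le ideal(2) unfolding \<Gamma>_def LIND_zero[of \<Theta> \<phi>] by blast
  qed
  have closed: "derives \<Gamma> \<phi> \<Longrightarrow> \<phi> \<in> \<Gamma>" for \<phi>
  proof (induction rule: derives.induct)
    case (mp \<phi> \<psi>)
    \<comment> \<open>Modus ponens in terms of ideals: the negation of \<open>\<psi>\<close> lies
      below the sum of the negations of \<open>\<phi>\<close> and
      \<open>Imp \<phi> \<psi>\<close>.\<close>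
    have "derives \<Theta> (Imp (Imp (Imp \<phi> \<psi>) \<psi>) (Imp (Neg \<psi>) (Neg (Imp \<phi> \<psi>))))" by (rule d_contra)
    then have "derives \<Theta> (Imp \<phi> (Imp (Neg \<psi>) (Neg (Imp \<phi> \<psi>))))" by (rule d_trans[OF d_assert])
    then have "derives \<Theta> (Imp (Neg (Neg \<phi>)) (Imp (Neg \<psi>) (Neg (Imp \<phi> \<psi>))))" by (rule d_trans[OF d_dn1])
    then have "derives \<Theta> (Imp (Neg \<psi>) (Oplus (Neg \<phi>) (Neg (Imp \<phi> \<psi>))))"
      unfolding Oplus_def by (rule d_exchI)
    moreover have "lind_rel \<Theta> `` {Oplus (Neg \<phi>) (Neg (Imp \<phi> \<psi>))} \<in> M"
      using ideal(3) mp.IH unfolding \<Gamma>_def by (simp flip: LIND_oplus)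
    ultimately show ?case unfolding \<Gamma>_def using le by blast
  qed (auto intro: base derives.ax1 derives.ax2 derives.ax3 derives.ax4)
  have "\<not> derives \<Gamma> (Neg (Imp a a))" for a
  proof
    assume "derives \<Gamma> (Neg (Imp a a))"
    then have one: "lind_rel \<Theta> `` {Neg (Neg (Imp a a))} \<in> M" using closed by (simp add: \<Gamma>_def)
    have "derives \<Theta> (Imp b (Neg (Neg (Imp a a))))" for b
      by (rule mp[OF mp[OF d_refl d_dn2] ax1])
    then have "M = mv_carrier (LIND \<Theta>)" using le[OF one] ideal(1) by (auto simp: LIND_carrier)
    then show False using M by (simp add: mv_maximal_ideal_def)
  qed
  then obtain U :: "(real ^ 'n) list" where U: "diff_valuation U" "diff_sat_set U \<Gamma>"
    using differential_completeness by metis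
  define v where "v = U ! 0"
  have ne: "U \<noteq> []" using U(1) by (simp add: diff_valuation_def)
  have "Imp a a \<in> \<Gamma>" for a by (rule base[OF d_refl])
  then have v: "v \<in> cbox 0 1" and sat: "\<And>\<phi>. \<phi> \<in> \<Gamma> \<Longrightarrow> eval \<phi> v = 1"
    using U(2) diff_sat_imp_eval_base[OF ne] unfolding diff_sat_set_def v_def by blast+
  have sat\<Theta>: "\<forall>\<theta>\<in>\<Theta>. eval \<theta> v = 1" using sat base hyp by blast
  have "M \<subseteq> point_ideal \<Theta> v"
  proof
    fix x assume x: "x \<in> M"
    then obtain \<phi> where \<phi>: "x = lind_rel \<Theta> `` {\<phi>}" using ideal(1) by (auto simp: LIND_carrier)
    have "Neg \<phi> \<in> \<Gamma>" unfolding \<Gamma>_def using le[OF _ d_dn1] x by (simp add: \<phi>)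
    then have "eval \<phi> v = 0" using sat[of "Neg \<phi>"] by simp
    then show "x \<in> point_ideal \<Theta> v" by (auto simp: \<phi> point_ideal_def)
  qed
  moreover have "J = M" if "mv_ideal (LIND \<Theta>) J" "M \<subseteq> J" "J \<noteq> mv_carrier (LIND \<Theta>)" for J
    using M that unfolding mv_maximal_ideal_def by auto
  ultimately have "M = point_ideal \<Theta> v"
    using mv_ideal_point_ideal[OF v sat\<Theta>] point_ideal_proper[OF v sat\<Theta>] by metis
  then show ?thesis by (rule that[OF v sat\<Theta>])
qed

lemma derives_Neg_iff: "derives \<Theta> (Neg \<phi>) \<longleftrightarrow> lind_rel \<Theta> `` {\<phi>} = mv_zero (LIND \<Theta>)"
proof -
  have "derives \<Theta> (Neg \<phi>) \<longleftrightarrow> \<phi> \<in> mv_zero (LIND \<Theta>)" by (simp add: LIND_def)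
  also have "\<dots> \<longleftrightarrow> lind_rel \<Theta> `` {\<phi>} = mv_zero (LIND \<Theta>)"
    unfolding LIND_zero[of \<Theta> undefined] cls_eq_iff by (auto simp: lind_rel_iff)
  finally show ?thesis .
qed

text \<open>The maximal ideals are the point ideals of the points satisfying
  \<open>\<Theta>\<close>. So the class of \<open>Neg \<psi>\<close> lies in all of them iff
  \<open>\<psi>\<close> holds at all these points, while it is zero iff \<open>\<psi>\<close> is
  derivable.\<close>

lemma semisimple_iff_models_derives:
  fixes \<Theta> :: "'n::finite form set"
  shows "mv_semisimple (LIND \<Theta>) \<longleftrightarrow> (\<forall>\<psi>. models \<Theta> \<psi> \<longrightarrow> derives \<Theta> \<psi>)"
proof (intro iffI allI impI)
  fix \<psi> assume ss: "mv_semisimple (LIND \<Theta>)" and \<psi>: "models \<Theta> \<psi>"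
  have "lind_rel \<Theta> `` {Neg \<psi>} \<in> M" if M: "mv_maximal_ideal (LIND \<Theta>) M" for M
  proof -
    obtain v where v: "v \<in> cbox 0 1" "\<forall>\<theta>\<in>\<Theta>. eval \<theta> v = 1" "M = point_ideal \<Theta> v"
      using maximal_ideal_eq_point_ideal[OF M] by blast
    then have "eval (Neg \<psi>) v = 0" using \<psi> by (simp add: models_def)
    then show ?thesis unfolding v(3) point_ideal_def by blast
  qed
  then have "lind_rel \<Theta> `` {Neg \<psi>} \<in> mv_carrier (LIND \<Theta>) \<inter> \<Inter> {I. mv_maximal_ideal (LIND \<Theta>) I}"
    by (simp add: LIND_carrier)
  then have "lind_rel \<Theta> `` {Neg \<psi>} = mv_zero (LIND \<Theta>)"
    using ss unfolding mv_semisimple_def by simp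
  then have "derives \<Theta> (Neg (Neg \<psi>))" by (simp add: derives_Neg_iff)
  then show "derives \<Theta> \<psi>" by (rule mp[OF _ d_dn1])
next
  assume complete: "\<forall>\<psi>. models \<Theta> \<psi> \<longrightarrow> derives \<Theta> \<psi>"
  have "x = mv_zero (LIND \<Theta>)"
    if x: "x \<in> mv_carrier (LIND \<Theta>)" "\<And>M. mv_maximal_ideal (LIND \<Theta>) M \<Longrightarrow> x \<in> M" for x
  proof -
    obtain \<phi> where \<phi>: "x = lind_rel \<Theta> `` {\<phi>}" using x(1) by (auto simp: LIND_carrier)
    have "eval \<phi> v = 0" if v: "v \<in> cbox 0 1" "\<forall>\<theta>\<in>\<Theta>. eval \<theta> v = 1" for v
      using x(2)[OF mv_maximal_ideal_point_ideal[OF v]] cls_in_point_ideal[OF v] by (simp add: \<phi>)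
    then have "models \<Theta> (Neg \<phi>)" by (simp add: models_def)
    then show ?thesis using complete by (simp add: \<phi> flip: derives_Neg_iff)
  qed
  moreover have "mv_zero (LIND \<Theta>) \<in> mv_carrier (LIND \<Theta>) \<inter> \<Inter> {I. mv_maximal_ideal (LIND \<Theta>) I}"
    using mv_algebra.zero_closed[OF mv_algebra_LIND] by (auto simp: mv_maximal_ideal_def mv_ideal_def)
  ultimately show "mv_semisimple (LIND \<Theta>)" unfolding mv_semisimple_def by (intro equalityI subsetI) simp_all
qed

section \<open>Comparison of the three consequence relations\<close>

lemma diff_models_iff_derives:
  fixes \<Theta> :: "'n::finite form set"
  shows "diff_models \<Theta> \<psi> \<longleftrightarrow> derives \<Theta> \<psi>"
  using derives_imp_diff_models[of \<Theta> \<psi>] differential_completeness[of \<Theta> \<psi>]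
  unfolding diff_models_def by metis

lemma models_iff_order_0:
  fixes \<Theta> :: "'n::finite form set"
  shows "models \<Theta> \<psi> \<longleftrightarrow>
    (\<forall>U. diff_valuation U \<and> diff_order U = 0 \<and> diff_sat_set U \<Theta> \<longrightarrow> diff_sat U \<psi>)"
proof -
  have order_0: "\<exists>u\<in>cbox 0 1. U = [u]" if U: "diff_valuation U" "diff_order U = 0" for U :: "(real ^ 'n) list"
  proof -
    obtain u where "U = [u]"
      using U by (cases U) (auto simp: diff_valuation_def diff_order_def)
    then show ?thesis using U(1) by (simp add: diff_valuation_order_0)
  qed
  have sat: "diff_sat_set [u] \<Theta> \<longleftrightarrow> (\<forall>\<theta>\<in>\<Theta>. eval \<theta> u = 1)" if "u \<in> cbox 0 1" for u
    using that by (simp add: diff_sat_set_def diff_sat_order_0)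
  show ?thesis
  proof (intro iffI allI impI)
    fix U :: "(real ^ 'n) list"
    assume "models \<Theta> \<psi>" and U: "diff_valuation U \<and> diff_order U = 0 \<and> diff_sat_set U \<Theta>"
    moreover obtain u where "u \<in> cbox 0 1" "U = [u]" using order_0[of U] U by metis
    ultimately show "diff_sat U \<psi>" using sat[of u] by (simp add: models_def diff_sat_order_0)
  next
    assume *: "\<forall>U. diff_valuation U \<and> diff_order U = 0 \<and> diff_sat_set U \<Theta> \<longrightarrow> diff_sat U \<psi>"
    show "models \<Theta> \<psi>"
      unfolding models_def
    proof (intro ballI impI)
      fix u :: "real ^ 'n" assume "u \<in> cbox 0 1" "\<forall>\<theta>\<in>\<Theta>. eval \<theta> u = 1"
      then show "eval \<psi> u = 1"
        using *[rule_format, of "[u]"] sat[of u]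
        by (simp add: diff_valuation_order_0 diff_order_def diff_sat_order_0)
    qed
  qed
qed

theorem theorem4p2:
  fixes \<Theta> :: "'n::finite form set"
  shows "(mv_semisimple (LIND \<Theta>) \<longleftrightarrow>
            conseq models \<Theta> = conseq diff_models \<Theta> \<and>
            conseq diff_models \<Theta> = conseq derives \<Theta>) \<and>
         (\<not> mv_semisimple (LIND \<Theta>) \<longleftrightarrow>
            (\<exists>\<psi>. (\<forall>U. diff_valuation U \<and> diff_order U = 0 \<and> diff_sat_set U \<Theta> \<longrightarrow> diff_sat U \<psi>) \<and>
                 (\<exists>U. diff_valuation U \<and> diff_sat_set U \<Theta> \<and> \<not> diff_sat U \<psi>)))"
proof -
  \<comment> \<open>Differential consequence is derivability, so both claims reduce to whether
    \<open>models\<close> implies \<open>derives\<close>; a formula for which this fails is the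
    witness in the second claim.\<close>
  have "models \<Theta> \<psi>" if "derives \<Theta> \<psi>" for \<psi>
    using derives_imp_models[OF that] by (auto simp: models_def)
  moreover have "(\<exists>U. diff_valuation U \<and> diff_sat_set U \<Theta> \<and> \<not> diff_sat U \<psi>) \<longleftrightarrow> \<not> derives \<Theta> \<psi>" for \<psi>
    unfolding diff_models_iff_derives[symmetric] diff_models_def by blast
  ultimately show ?thesis
    unfolding semisimple_iff_models_derives models_iff_order_0[symmetric] conseq_def diff_models_iff_derives
    by blast
qed

end
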